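(* Let $X$ be the complex $K3$ surface with transcendental lattice $\langle 6\rangle\oplus\langle 2\rangle$, and consider the elliptic fibration on $X$ associated with the primitive embedding of $A_5\oplus A_1$ in $L=N(A_9^2D_6)$ given by $A_1=\langle a_1\rangle\subset A_9^{(1)}$ and $A_5$ embedded in $D_6$ as $i_2(A_5)=(d_6,d_4,d_3,d_2,d_1)$. Let $W$ and $N$ be the orthogonal complements of the image of $A_5\oplus A_1$ in $L$ and in $L_{\rm root}$, and let $Z_1,\dots,Z_9,Z_{11},Z_{12}$ be the sections defined in the context. (1) The Mordell-Weil lattice can be generated by $Z_2$ and any one of the sections $Z_1,Z_3,Z_7,Z_9$ (whose classes in $W/N$ have order $10$) or $Z_5$ (whose class in $W/N$ has order $2$). It can also be generated by $Z_1$ and $Z_3$, or by $Z_1$ and $Z_9$. (2) The rational quadratic forms associated to the height matrices of these various pairs of generators are all equivalent to the quadratic form $\frac1{10}(x^2+15y^2)$. (3) The sublattice $N/N_{\rm root}$, which has index $10$ in $W/N_{\rm root}$, is generated by $Z_{11}=-5Z_2$ and $Z_{12}$.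
   Context: Root lattices are negative definite (roots have square $-2$). $a_1,\dots,a_9$ are the simple roots of $A_9$ (consecutive ones joined), $d_1,\dots,d_6$ those of $D_6$ in Bourbaki numbering: chain $d_1-d_2-d_3-d_4$, with $d_5,d_6$ both joined to $d_4$. An embedding $(d_{j_1},\dots,d_{j_5})$ sends the consecutive simple roots of $A_5$ to the listed roots. Let $\alpha=\frac1{10}(9a_1+8a_2+7a_3+6a_4+5a_5+4a_6+3a_7+2a_8+a_9)$, write $i$ for the class of $i\alpha$ in $A_9^*/A_9$, and in $D_6^*/D_6$ write $[1]$, $[3]$ for the classes of $\delta_6=\frac12(d_1+2d_2+3d_3+4d_4+2d_5+3d_6)$ and $\tilde\delta_6=\frac12(d_1+2d_2+3d_3+4d_4+3d_5+2d_6)$. The Niemeier lattice $L=N(A_9^2D_6)$ is generated in $(A_9^* )^2\oplus D_6^*$ by $L_{\rm root}=A_9^{(1)}\oplus A_9^{(2)}\oplus D_6$ and the cosets $[2,4,0],[5,0,1],[0,5,3]$. With $W=(A_5\oplus A_1)^{\perp_L}$ and $N=(A_5\oplus A_1)^{\perp_{L_{\rm root}}}$ one has $W_{\rm root}=N_{\rm root}$ (sublattices generated by vectors of square $-2$), here equal to $\langle a_3,\dots,a_9\rangle\oplus A_9^{(2)}\simeq A_7\oplus A_9$, and it is primitive in $W$. $W$ is the frame of the associated elliptic fibration on $X$: $NS(X)\simeq U\oplus W$, with $U$ generated by the fiber class $F$ and the zero section $O$ ($F^2=0$, $O^2=-2$, $F\cdot O=1$). The Mordell-Weil group is $W/W_{\rm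 root}$ (torsion-free here), a section of class $O+kF+\omega$ with $\omega\in W$ corresponding to the class of $\omega$. The Mordell-Weil lattice is $W/W_{\rm root}$ with the height pairing, i.e. minus the bilinear form of the orthogonal projections to $(W_{\rm root})^\perp\otimes\mathbb Q$ (Shioda's height pairing). Relations between sections are relations in the Mordell-Weil group; equivalence of quadratic forms is under $GL_2(\mathbb Z)$. The class of a section in $W/N$ is the class of $\omega$. Let $\alpha_j\in A_9^*$ ($1\le j\le 9$) be the dual basis: $\alpha_j\cdot a_j=1$, $\alpha_j\cdot a_i=0$ for $i\ne j$ (so $-\alpha_j=j\alpha-(j-1)a_1-\dots-a_{j-1}$). In a triple $[x,y,z]$ the entries lie in $(A_9^{(1)})^*,(A_9^{(2)})^*,D_6^*$. The sections are: $Z_1=O+3F+[\alpha_4,\alpha_3,\tilde\delta_6]$, $Z_2=O+2F+[\alpha_8,\alpha_6,0]$, $Z_3=O+2F+[\alpha_2,\alpha_9,\tilde\delta_6]$, $Z_4=O+2F+[\alpha_6,\alpha_2,0]$, $Z_5=O+2F+[0,\alpha_5,\tilde\delta_6]$, $Z_6=O+2F+[\alpha_4,\alpha_8,0]$, $Z_7=O+2F+[\alpha_8,\alpha_1,\tilde\delta_6]$, $Z_8=O+2F+[\alpha_2,\alpha_4,0]$, $Z_9=O+3F+[\alpha_6,\alpha_7,\tilde\delta_6]$, $Z_{11}=O+2F+[a_1+2a_2+a_3,0,0]$, $Z_{12}=O+3F+[0,0,2\tilde\delta_6]$. *)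

theory Defs
  imports
    "HOL-Analysis.Cartesian_Space"
    "HOL-Algebra.Multiplicative_Group"
    "HOL-Library.Function_Algebras"
    "HOL-Library.Product_Plus"
begin

definition add_grp :: "'v::ab_group_add set \<Rightarrow> 'v monoid" where
  "add_grp S = \<lparr>carrier = S, mult = (+), one = 0\<rparr>"

definition int_span :: "'v::ab_group_add set \<Rightarrow> 'v set" where
  "int_span S = generate (add_grp UNIV) S"

definition orth_in :: "('v \<Rightarrow> 'v \<Rightarrow> rat) \<Rightarrow> 'v set \<Rightarrow> 'v set \<Rightarrow> 'v set" where
  "orth_in b S T = {x \<in> S. \<forall>y \<in> T. b x y = 0}"

definition root_part :: "('v::ab_group_add \<Rightarrow> 'v \<Rightarrow> rat) \<Rightarrow> 'v set \<Rightarrow> 'v set" where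
  "root_part b S = int_span {x \<in> S. b x x = -2}"

definition osum_form ::
  "('v \<Rightarrow> 'v \<Rightarrow> rat) \<Rightarrow> ('w \<Rightarrow> 'w \<Rightarrow> rat) \<Rightarrow> 'v \<times> 'w \<Rightarrow> 'v \<times> 'w \<Rightarrow> rat"  (infixr \<open>\<oplus>\<^sub>f\<close> 65) where
  "(b \<oplus>\<^sub>f c) p q = b (fst p) (fst q) + c (snd p) (snd q)"

definition rank_one_form :: "int \<Rightarrow> int \<Rightarrow> int \<Rightarrow> rat" where
  "rank_one_form n x y = of_int (n * x * y)"

definition lattice_isometry ::
  "('v::ab_group_add \<Rightarrow> 'v \<Rightarrow> rat) \<Rightarrow> 'v set \<Rightarrow> ('w::ab_group_add \<Rightarrow> 'w \<Rightarrow> rat) \<Rightarrow> 'w set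
    \<Rightarrow> ('v \<Rightarrow> 'w) \<Rightarrow> bool" where
  "lattice_isometry b S c T f \<longleftrightarrow> bij_betw f S T \<and>
     (\<forall>x\<in>S. \<forall>y\<in>S. f (x + y) = f x + f y \<and> c (f x) (f y) = b x y)"

definition isometric ::
  "('v::ab_group_add \<Rightarrow> 'v \<Rightarrow> rat) \<Rightarrow> 'v set \<Rightarrow> ('w::ab_group_add \<Rightarrow> 'w \<Rightarrow> rat) \<Rightarrow> 'w set \<Rightarrow> bool" where
  "isometric b S c T \<longleftrightarrow> (\<exists>f. lattice_isometry b S c T f)"

text \<open>The vectors of the ambient group having a positive multiple in \<open>S\<close>; if the ambient group is
  a rational vector space, this is the copy of \<open>S \<otimes> \<rat>\<close> in it.\<close>

definition rat_hull :: "'v::ab_group_add set \<Rightarrow> 'v set" where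
  "rat_hull S = {v. \<exists>n::nat. n > 0 \<and> v [^]\<^bsub>add_grp UNIV\<^esub> n \<in> S}"

definition orth_proj :: "('v::ab_group_add \<Rightarrow> 'v \<Rightarrow> rat) \<Rightarrow> 'v set \<Rightarrow> 'v \<Rightarrow> 'v" where
  "orth_proj b R x = (THE p. p \<in> orth_in b UNIV R \<and> x - p \<in> rat_hull R)"

text \<open>The coordinate of a vector at the \<open>i\<close>-th simple root is its value at \<open>i\<close>, for
  \<open>i \<in> {1..n}\<close>; all other values are zero. Roots have square \<open>-2\<close>.\<close>

type_synonym qvec = "nat \<Rightarrow> rat"

definition root_form :: "(nat \<times> nat) set \<Rightarrow> nat \<Rightarrow> qvec \<Rightarrow> qvec \<Rightarrow> rat" where
  "root_form E n x y = (\<Sum>i\<in>{1..n}. \<Sum>j\<in>{1..n}.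
     x i * (if i = j then -2 else if (i, j) \<in> E \<or> (j, i) \<in> E then 1 else 0) * y j)"

definition rat_space :: "nat \<Rightarrow> qvec set" where
  "rat_space n = {x. \<forall>i. i \<notin> {1..n} \<longrightarrow> x i = 0}"

definition root_lattice :: "nat \<Rightarrow> qvec set" where
  "root_lattice n = {x \<in> rat_space n. \<forall>i. x i \<in> \<int>}"

definition simple_root :: "nat \<Rightarrow> qvec" where
  "simple_root i = (\<lambda>j. if j = i then 1 else 0)"

definition dual_basis :: "(nat \<times> nat) set \<Rightarrow> nat \<Rightarrow> nat \<Rightarrow> qvec" where
  "dual_basis E n j = (THE x. x \<in> rat_space n \<and>
     (\<forall>i\<in>{1..n}. root_form E n x (simple_root i) = (if i = j then 1 else 0)))"

definition scale :: "rat \<Rightarrow> qvec \<Rightarrow> qvec" where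
  "scale c x = (\<lambda>i. c * x i)"

definition vec_of :: "rat list \<Rightarrow> qvec" where
  "vec_of xs = (\<lambda>i. if i \<in> {1..length xs} then xs ! (i - 1) else 0)"

definition A_edges :: "(nat \<times> nat) set" where
  "A_edges = {(i, Suc i) | i. True}"

definition D6_edges :: "(nat \<times> nat) set" where
  "D6_edges = {(1,2), (2,3), (3,4), (4,5), (4,6)}"

definition E8_edges :: "(nat \<times> nat) set" where
  "E8_edges = {(1,3), (3,4), (2,4), (4,5), (5,6), (6,7), (7,8)}"

abbreviation A_form :: "nat \<Rightarrow> qvec \<Rightarrow> qvec \<Rightarrow> rat" where
  "A_form \<equiv> root_form A_edges"

abbreviation D6_form :: "qvec \<Rightarrow> qvec \<Rightarrow> rat" where
  "D6_form \<equiv> root_form D6_edges 6"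

abbreviation E8_form :: "qvec \<Rightarrow> qvec \<Rightarrow> rat" where
  "E8_form \<equiv> root_form E8_edges 8"

text \<open>The map sending the \<open>k\<close>-th simple root to the simple root listed at position \<open>k\<close>.\<close>

definition root_embedding :: "nat list \<Rightarrow> qvec \<Rightarrow> qvec" where
  "root_embedding js x = (\<Sum>k\<in>{1..length js}. scale (x k) (simple_root (js ! (k - 1))))"

type_synonym ambient = "qvec \<times> qvec \<times> qvec"

definition L_form :: "ambient \<Rightarrow> ambient \<Rightarrow> rat" where
  "L_form = A_form 9 \<oplus>\<^sub>f A_form 9 \<oplus>\<^sub>f D6_form"

definition L_root :: "ambient set" where
  "L_root = root_lattice 9 \<times> root_lattice 9 \<times> root_lattice 6"

definition alpha :: qvec where
  "alpha = vec_of [9/10, 8/10, 7/10, 6/10, 5/10, 4/10, 3/10, 2/10, 1/10]"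

definition delta6 :: qvec where
  "delta6 = scale (1/2) (vec_of [1, 2, 3, 4, 2, 3])"

definition delta6' :: qvec where
  "delta6' = scale (1/2) (vec_of [1, 2, 3, 4, 3, 2])"

definition glue_coset :: "nat \<Rightarrow> nat \<Rightarrow> qvec \<Rightarrow> ambient set" where
  "glue_coset i j \<delta> =
     L_root #>\<^bsub>add_grp UNIV\<^esub> (scale (of_nat i) alpha, scale (of_nat j) alpha, \<delta>)"

definition Niemeier_A9A9D6 :: "ambient set" where
  "Niemeier_A9A9D6 =
     int_span (L_root \<union> glue_coset 2 4 0 \<union> glue_coset 5 0 delta6 \<union> glue_coset 0 5 delta6')"

definition emb :: "qvec \<times> qvec \<Rightarrow> ambient" where
  "emb = (\<lambda>(x, y). (root_embedding [1] y, 0, root_embedding [6, 4, 3, 2, 1] x))"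

definition W :: "ambient set" where
  "W = orth_in L_form Niemeier_A9A9D6 (emb ` (root_lattice 5 \<times> root_lattice 1))"

definition N :: "ambient set" where
  "N = orth_in L_form L_root (emb ` (root_lattice 5 \<times> root_lattice 1))"

abbreviation W_root :: "ambient set" where "W_root \<equiv> root_part L_form W"
abbreviation N_root :: "ambient set" where "N_root \<equiv> root_part L_form N"

text \<open>The hyperbolic plane in the basis \<open>O, F\<close>: the pair \<open>(m, k)\<close> is \<open>mO + kF\<close>, with
  \<open>O\<^sup>2 = -2\<close>, \<open>O \<cdot> F = 1\<close>, \<open>F\<^sup>2 = 0\<close> (so that \<open>O + F, F\<close> is a standard hyperbolic basis).\<close>

definition U_form :: "int \<times> int \<Rightarrow> int \<times> int \<Rightarrow> rat" where
  "U_form p q = of_int (- 2 * fst p * fst q + fst p * snd q + snd p * fst q)"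

text \<open>\<open>H\<close> with values in \<open>'h\<close> stands for the cup product on \<open>H\<^sup>2(X, \<int>)\<close>: the K3 lattice
  \<open>U\<^sup>3 \<oplus> E\<^sub>8\<^sup>2\<close> with \<open>E\<^sub>8\<close> negative definite.\<close>

definition K3_lattice_form :: "('h::ab_group_add \<Rightarrow> 'h \<Rightarrow> rat) \<Rightarrow> bool" where
  "K3_lattice_form H \<longleftrightarrow>
     isometric H UNIV
       (U_form \<oplus>\<^sub>f U_form \<oplus>\<^sub>f U_form \<oplus>\<^sub>f E8_form \<oplus>\<^sub>f E8_form)
       (UNIV \<times> UNIV \<times> UNIV \<times> root_lattice 8 \<times> root_lattice 8)"

text \<open>\<open>NS\<close> is the Neron-Severi lattice inside \<open>H\<^sup>2(X, \<int>)\<close> (a primitive sublattice), and the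
  transcendental lattice is its orthogonal complement.\<close>

definition NS_with_transcendental_6_2 :: "('h::ab_group_add \<Rightarrow> 'h \<Rightarrow> rat) \<Rightarrow> 'h set \<Rightarrow> bool" where
  "NS_with_transcendental_6_2 H NS \<longleftrightarrow>
     orth_in H UNIV (orth_in H UNIV NS) = NS \<and>
     isometric H (orth_in H UNIV NS) (rank_one_form 6 \<oplus>\<^sub>f rank_one_form 2) UNIV"

text \<open>The elliptic fibration with frame \<open>W\<close>, given by the isometry \<open>U \<oplus> W \<cong> NS(X)\<close>, with
  \<open>U\<close> spanned by the zero section \<open>O\<close> and the fibre class \<open>F\<close>.\<close>

definition fibration_with_frame_W ::
  "('h::ab_group_add \<Rightarrow> 'h \<Rightarrow> rat) \<Rightarrow> 'h set \<Rightarrow> ((int \<times> int) \<times> ambient \<Rightarrow> 'h) \<Rightarrow> bool" where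
  "fibration_with_frame_W H NS \<phi> \<longleftrightarrow>
     lattice_isometry (U_form \<oplus>\<^sub>f L_form) (UNIV \<times> W) H NS \<phi>"

definition MW :: "ambient set monoid" where
  "MW = add_grp W Mod W_root"

text \<open>A section of class \<open>O + kF + \<omega>\<close>, with \<open>\<omega> \<in> W\<close>, corresponds to the class of \<open>\<omega>\<close> in
  \<open>W / W_root\<close>.\<close>

definition sect :: "((int \<times> int) \<times> ambient \<Rightarrow> 'h) \<Rightarrow> int \<Rightarrow> ambient \<Rightarrow> 'h" where
  "sect \<phi> k \<omega> = \<phi> ((1, k), \<omega>)"

definition frame_part :: "((int \<times> int) \<times> ambient \<Rightarrow> 'h) \<Rightarrow> 'h \<Rightarrow> ambient" where
  "frame_part \<phi> Z = snd (inv_into (UNIV \<times> W) \<phi> Z)"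

definition class_mod :: "((int \<times> int) \<times> ambient \<Rightarrow> 'h) \<Rightarrow> ambient set \<Rightarrow> 'h \<Rightarrow> ambient set" where
  "class_mod \<phi> R Z = R #>\<^bsub>add_grp W\<^esub> frame_part \<phi> Z"

abbreviation mw :: "((int \<times> int) \<times> ambient \<Rightarrow> 'h) \<Rightarrow> 'h \<Rightarrow> ambient set" where
  "mw \<phi> Z \<equiv> class_mod \<phi> W_root Z"

text \<open>The value does not depend on the representatives, because \<open>orth_proj\<close> kills \<open>W_root\<close>.\<close>

definition height :: "ambient set \<Rightarrow> ambient set \<Rightarrow> rat" where
  "height P Q = (THE h. \<forall>x\<in>P. \<forall>y\<in>Q.
     h = - L_form (orth_proj L_form W_root x) (orth_proj L_form W_root y))"

definition height_matrix :: "ambient set \<Rightarrow> ambient set \<Rightarrow> rat^2^2" where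
  "height_matrix P Q = vector [vector [height P P, height P Q], vector [height Q P, height Q Q]]"

definition quad_form :: "rat^2^2 \<Rightarrow> rat^2 \<Rightarrow> rat" where
  "quad_form M v = (\<Sum>i\<in>UNIV. \<Sum>j\<in>UNIV. M $ i $ j * v $ i * v $ j)"

definition GL2Z_equivalent :: "(rat^2 \<Rightarrow> rat) \<Rightarrow> (rat^2 \<Rightarrow> rat) \<Rightarrow> bool" where
  "GL2Z_equivalent q q' \<longleftrightarrow>
     (\<exists>P::int^2^2. invertible P \<and> (\<forall>v. q' v = q ((\<chi> i j. of_int (P $ i $ j)) *v v)))"

abbreviation \<alpha>\<^sub>9 :: "nat \<Rightarrow> qvec" where "\<alpha>\<^sub>9 \<equiv> dual_basis A_edges 9"

definition "Z1 \<phi> = sect \<phi> 3 (\<alpha>\<^sub>9 4, \<alpha>\<^sub>9 3, delta6')"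
definition "Z2 \<phi> = sect \<phi> 2 (\<alpha>\<^sub>9 8, \<alpha>\<^sub>9 6, 0)"
definition "Z3 \<phi> = sect \<phi> 2 (\<alpha>\<^sub>9 2, \<alpha>\<^sub>9 9, delta6')"
definition "Z4 \<phi> = sect \<phi> 2 (\<alpha>\<^sub>9 6, \<alpha>\<^sub>9 2, 0)"
definition "Z5 \<phi> = sect \<phi> 2 (0, \<alpha>\<^sub>9 5, delta6')"
definition "Z6 \<phi> = sect \<phi> 2 (\<alpha>\<^sub>9 4, \<alpha>\<^sub>9 8, 0)"
definition "Z7 \<phi> = sect \<phi> 2 (\<alpha>\<^sub>9 8, \<alpha>\<^sub>9 1, delta6')"
definition "Z8 \<phi> = sect \<phi> 2 (\<alpha>\<^sub>9 2, \<alpha>\<^sub>9 4, 0)"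
definition "Z9 \<phi> = sect \<phi> 3 (\<alpha>\<^sub>9 6, \<alpha>\<^sub>9 7, delta6')"
definition "Z11 \<phi> = sect \<phi> 2 (vec_of [1, 2, 1], 0, 0)"
definition "Z12 \<phi> = sect \<phi> 3 (0, 0, scale 2 delta6')"

end

theory Submission
  imports Defs
begin

text \<open>An element \<open>(x, y, z)\<close> of \<open>W\<close> has \<open>x\<^sub>1 = m/5\<close>, \<open>x\<^sub>2 = 2m/5\<close> and \<open>z = c \<delta>\<close> for \<open>\<delta> = delta6'\<close> and
  integers \<open>m, c\<close>, and the glue of \<open>L\<close> then forces \<open>x\<close> and \<open>y\<close> into the classes \<open>-2m\<close> and
  \<open>5c - 4m\<close> of \<open>A\<^sub>9\<^sup>*/A\<^sub>9\<close>. So \<open>(m, c)\<close> maps \<open>W\<close> onto \<open>\<int>\<^sup>2\<close> with kernel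
  \<open>\<langle>a\<^sub>3, \<dots>, a\<^sub>9\<rangle> \<oplus> A\<^sub>9\<^sup>(\<^sup>2\<^sup>)\<close>. The minimal norms of the classes of \<open>A\<^sub>9\<^sup>*/A\<^sub>9\<close> leave no root outside this
  kernel, which is therefore \<open>W_root\<close>, and the Mordell-Weil lattice is \<open>\<int>\<^sup>2\<close> with height
  \<open>(m\<^sup>2 + 15c\<^sup>2)/10\<close>. The sublattice \<open>N\<close> is given by \<open>5 | m\<close> and \<open>2 | c\<close>. Two sections generate iff
  their coordinates \<open>(m, c)\<close> have determinant \<open>\<plusminus>1\<close>, and then the inverse of that coordinate matrix
  is the required equivalence of forms.\<close>

section \<open>The dual lattice of \<open>A\<^sub>9\<close>\<close>

lemma interval_1_9: "{1..9::nat} = {1, 2, 3, 4, 5, 6, 7, 8, 9}"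
  by auto

lemma interval_1_6: "{1..6::nat} = {1, 2, 3, 4, 5, 6}"
  by auto

text \<open>With x 0 = x 10 = 0 understood, this is minus the standard product of the vectors of
  consecutive differences, the usual model of A_9 in Z^10; definiteness is then visible.\<close>

lemma A9_form_eq:
  "A_form 9 x y = - (x 1 * y 1 + (x 2 - x 1) * (y 2 - y 1) + (x 3 - x 2) * (y 3 - y 2)
     + (x 4 - x 3) * (y 4 - y 3) + (x 5 - x 4) * (y 5 - y 4) + (x 6 - x 5) * (y 6 - y 5)
     + (x 7 - x 6) * (y 7 - y 6) + (x 8 - x 7) * (y 8 - y 7) + (x 9 - x 8) * (y 9 - y 8)
     + x 9 * y 9)"
  unfolding root_form_def A_edges_def interval_1_9
  by (simp add: eval_nat_numeral) (simp add: algebra_simps)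

lemma D6_form_eq:
  "D6_form x y = x 1 * (- 2 * y 1 + y 2) + x 2 * (y 1 - 2 * y 2 + y 3) + x 3 * (y 2 - 2 * y 3 + y 4)
     + x 4 * (y 3 - 2 * y 4 + y 5 + y 6) + x 5 * (y 4 - 2 * y 5) + x 6 * (y 4 - 2 * y 6)"
  unfolding root_form_def D6_edges_def interval_1_6
  by (simp add: algebra_simps)

lemma L_form_eq [simp]:
  "L_form (x, y, z) (x', y', z') = A_form 9 x x' + A_form 9 y y' + D6_form z z'"
  by (simp add: L_form_def osum_form_def)

lemma rat_space_9_ext:
  assumes "x \<in> rat_space 9" "y \<in> rat_space 9" "\<And>i. i \<in> {1..9} \<Longrightarrow> x i = y i"
  shows "x = y"
proof
  fix i
  show "x i = y i"
    using assms by (cases "i \<in> {1..9}") (auto simp: rat_space_def)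
qed

lemma alpha_apply: "alpha i = (if i \<in> {1..9} then (10 - of_nat i) / 10 else 0)"
proof (cases "i \<in> {1..9}")
  case True
  then show ?thesis
    unfolding interval_1_9 alpha_def vec_of_def by (auto simp: eval_nat_numeral)
qed (auto simp: alpha_def vec_of_def)

lemma delta6'_apply:
  "delta6' i = (if i = 1 then 1/2 else if i = 2 then 1 else if i = 3 then 3/2 else if i = 4 then 2
     else if i = 5 then 3/2 else if i = 6 then 1 else 0)"
  by (cases "i \<in> {1..6}")
    (auto simp: delta6'_def scale_def vec_of_def interval_1_6 eval_nat_numeral less_Suc_eq_le
      nth_Cons' split: if_splits)

lemma delta6_apply:
  "delta6 i = (if i = 1 then 1/2 else if i = 2 then 1 else if i = 3 then 3/2 else if i = 4 then 2
     else if i = 5 then 1 else if i = 6 then 3/2 else 0)"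
  by (cases "i \<in> {1..6}")
    (auto simp: delta6_def scale_def vec_of_def interval_1_6 eval_nat_numeral less_Suc_eq_le
      nth_Cons' split: if_splits)

text \<open>The coset \<open>k\<alpha> + A\<^sub>9\<close>, as the \<open>i\<close>-th coordinate of \<open>\<alpha>\<close> is \<open>1 - i/10\<close>.\<close>

definition A9_coset :: "int \<Rightarrow> qvec set" where
  "A9_coset k = {x \<in> rat_space 9. \<forall>i\<in>{1..9}. x i + of_int k * of_nat i / 10 \<in> \<int>}"

lemma A9_norm_nonneg: "0 \<le> - A_form 9 x x"
proof -
  have "0 \<le> x 1 * x 1 + (x 2 - x 1) * (x 2 - x 1) + (x 3 - x 2) * (x 3 - x 2)
     + (x 4 - x 3) * (x 4 - x 3) + (x 5 - x 4) * (x 5 - x 4) + (x 6 - x 5) * (x 6 - x 5)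
     + (x 7 - x 6) * (x 7 - x 6) + (x 8 - x 7) * (x 8 - x 7) + (x 9 - x 8) * (x 9 - x 8)
     + x 9 * x 9"
    by (intro add_nonneg_nonneg zero_le_square)
  then show ?thesis
    unfolding A9_form_eq by linarith
qed

lemma A9_norm_eq_0:
  assumes "x \<in> rat_space 9" "A_form 9 x x = 0"
  shows "x = 0"
proof -
  have "x 1 * x 1 + ((x 2 - x 1) * (x 2 - x 1) + ((x 3 - x 2) * (x 3 - x 2)
     + ((x 4 - x 3) * (x 4 - x 3) + ((x 5 - x 4) * (x 5 - x 4) + ((x 6 - x 5) * (x 6 - x 5)
     + ((x 7 - x 6) * (x 7 - x 6) + ((x 8 - x 7) * (x 8 - x 7) + ((x 9 - x 8) * (x 9 - x 8)
     + x 9 * x 9)))))))) = 0"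
    using assms(2) unfolding A9_form_eq by linarith
  \<comment> \<open>All the squares vanish, so \<open>x 1\<close> is zero and neighbouring
    coordinates agree.\<close>
  then have "\<forall>i\<in>{1,2,3,4,5,6,7,8,9}. x i = 0"
    by (simp add: add_nonneg_eq_0_iff)
  then show ?thesis
    using assms(1) unfolding interval_1_9[symmetric]
    by (intro rat_space_9_ext) (auto simp: rat_space_def)
qed

lemma A9_form_expand:
  "A_form 9 x y = (\<Sum>i\<in>{1..9}. y i * A_form 9 x (simple_root i))"
  unfolding A9_form_eq interval_1_9 simple_root_def by simp (simp add: algebra_simps)

text \<open>Expanding the square of \<open>x\<close> in simple roots, every term vanishes, and the
  form is definite. The second alternative alone gives uniqueness of the dual basis; the mixed case
  gives uniqueness of the projection to the complement of a_3, ..., a_9.\<close>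

lemma A9_orth_imp_0:
  assumes "x \<in> rat_space 9"
    and "\<And>i. i \<in> {1..9} \<Longrightarrow> x i = 0 \<or> A_form 9 x (simple_root i) = 0"
  shows "x = 0"
proof (rule A9_norm_eq_0[OF assms(1)])
  show "A_form 9 x x = 0"
    unfolding A9_form_expand[of x x] using assms(2) by (intro sum.neutral) auto
qed

text \<open>The entries are those of minus the inverse Cartan matrix of A_9, that is -min(i,j) (10 -
  max(i,j)) / 10.\<close>

lemma A9_dual_basis:
  assumes "j \<in> {1..9}"
  shows "\<alpha>\<^sub>9 j = (\<lambda>i. if i \<in> {1..9} then if i \<le> j then - (of_nat i * (10 - of_nat j) / 10)
    else - (of_nat j * (10 - of_nat i) / 10) else 0)" (is "_ = ?v")
  unfolding dual_basis_def
proof (rule the_equality)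
  have "A_form 9 ?v (simple_root i) = (if i = j then 1 else 0)" if "i \<in> {1..9}" for i
    using that assms unfolding interval_1_9 A9_form_eq simple_root_def
    by (elim insertE emptyE) (simp_all add: field_simps)
  then show v: "?v \<in> rat_space 9 \<and>
      (\<forall>i\<in>{1..9}. A_form 9 ?v (simple_root i) = (if i = j then 1 else 0))"
    by (auto simp: rat_space_def)
  fix x
  assume x: "x \<in> rat_space 9 \<and>
      (\<forall>i\<in>{1..9}. A_form 9 x (simple_root i) = (if i = j then 1 else 0))"
  have "x - ?v = 0"
  proof (rule A9_orth_imp_0)
    show "x - ?v \<in> rat_space 9"
      using x v by (auto simp: rat_space_def)
    have "A_form 9 (x - ?v) y = A_form 9 x y - A_form 9 ?v y" for y
      unfolding A9_form_eq by (simp add: algebra_simps)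
    then show "(x - ?v) i = 0 \<or> A_form 9 (x - ?v) (simple_root i) = 0" if "i \<in> {1..9}" for i
      using x v that by simp
  qed
  then show "x = ?v"
    by simp
qed

lemma A9_cosetD:
  "x \<in> A9_coset k \<Longrightarrow> i \<in> {1..9} \<Longrightarrow> x i + of_int k * of_nat i / 10 \<in> \<int>"
  by (simp add: A9_coset_def)

text \<open>This is the congruence of alpha_j with -j alpha modulo A_9; the integer left over at
  coordinate i is -min(i,j).\<close>

lemma A9_dual_basis_coset:
  assumes "j \<in> {1..9}"
  shows "\<alpha>\<^sub>9 j \<in> A9_coset (- int j)"
proof -
  have "\<alpha>\<^sub>9 j i + of_int (- int j) * of_nat i / 10 = of_int (- int (min i j))"
    if "i \<in> {1..9}" for i
    using that by (simp add: A9_dual_basis[OF assms] field_simps)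
  then show ?thesis
    unfolding A9_coset_def using assms
    by (auto simp: rat_space_def A9_dual_basis)
qed

lemma A9_coset_0: "A9_coset 0 = root_lattice 9"
  by (force simp: A9_coset_def root_lattice_def rat_space_def)

lemma A9_coset_add:
  assumes "x \<in> A9_coset k" "y \<in> A9_coset l"
  shows "x + y \<in> A9_coset (k + l)"
proof -
  have "(x + y) i + of_int (k + l) * of_nat i / 10 =
    (x i + of_int k * of_nat i / 10) + (y i + of_int l * of_nat i / 10)" for i
    by (simp add: field_simps)
  then have "(x + y) i + of_int (k + l) * of_nat i / 10 \<in> \<int>" if "i \<in> {1..9}" for i
    using A9_cosetD[OF assms(1) that] A9_cosetD[OF assms(2) that] by (simp only: Ints_add)
  then show ?thesis
    using assms unfolding A9_coset_def by (auto simp: rat_space_def)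
qed

lemma A9_coset_uminus:
  assumes "x \<in> A9_coset k"
  shows "- x \<in> A9_coset (- k)"
proof -
  have "(- x) i + of_int (- k) * of_nat i / 10 = - (x i + of_int k * of_nat i / 10)" for i
    by (simp add: field_simps)
  then have "(- x) i + of_int (- k) * of_nat i / 10 \<in> \<int>" if "i \<in> {1..9}" for i
    using A9_cosetD[OF assms that] by (simp only: Ints_minus)
  then show ?thesis
    using assms unfolding A9_coset_def by (auto simp: rat_space_def)
qed

lemma A9_coset_mod:
  assumes "x \<in> A9_coset k" "k mod 10 = l mod 10"
  shows "x \<in> A9_coset l"
proof -
  obtain d where d: "l = k + 10 * d"
    using assms(2) by (metis mod_eqE add.commute mult.commute diff_add_cancel)
  have "x i + of_int l * of_nat i / 10 = (x i + of_int k * of_nat i / 10) + of_int (d * int i)" for i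
    by (simp add: d field_simps)
  then have "x i + of_int l * of_nat i / 10 \<in> \<int>" if "i \<in> {1..9}" for i
    using A9_cosetD[OF assms(1) that] by (simp only: Ints_add Ints_of_int)
  then show ?thesis
    using assms(1) unfolding A9_coset_def by auto
qed

lemma scale_alpha_coset: "scale (of_int k) alpha \<in> A9_coset k"
  by (auto simp: A9_coset_def rat_space_def scale_def alpha_apply field_simps)

lemma root_lattice_9_coset_mod:
  "x \<in> A9_coset k \<Longrightarrow> 10 dvd k \<Longrightarrow> x \<in> root_lattice 9"
  using A9_coset_mod[of x k 0] by (simp add: A9_coset_0 mod_eq_0_iff_dvd)

text \<open>With \<open>x\<^sub>0 = x\<^sub>1\<^sub>0 = 0\<close>, the norm is the sum of the squares of the ten differences
  \<open>e\<^sub>i = x\<^sub>i\<^sub>+\<^sub>1 - x\<^sub>i\<close>, which sum to \<open>0\<close> and have the form \<open>e\<^sub>i = n\<^sub>i - k/10\<close> with \<open>n\<^sub>i \<in> \<int>\<close>. The bound is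
  the sum of the inequalities \<open>n\<^sub>i\<^sup>2 \<ge> n\<^sub>i\<close>.\<close>

lemma A9_coset_norm_ge:
  assumes "x \<in> A9_coset k"
  shows "of_int (k * (10 - k)) / 10 \<le> - A_form 9 x x"
proof -
  define s :: rat where "s = of_int k / 10"
  define f where "f i = x i + s * of_nat i" for i
  have f: "f i \<in> \<int>" if "i \<in> {1..9}" for i
    using assms that by (simp add: A9_coset_def f_def s_def)
  \<comment> \<open>With d = a - b and n = d + s, the inequality n (n - 1) >= 0 reads t d + c <=
    d^2, where c = s - s^2. The linear terms telescope to 0 over the ten differences, leaving 10 c =
    k (10 - k) / 10.\<close>
  define t where "t = 1 - 2 * s"
  define c where "c = t * s + s\<^sup>2"
  have bound: "t * a - t * b + c \<le> (a - b) * (a - b)" if "a - b + s \<in> \<int>" for a b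
  proof -
    obtain n where n: "a - b + s = of_int n"
      using \<open>a - b + s \<in> \<int>\<close> by (rule Ints_cases)
    have "0 \<le> n * (n - 1)"
      by (simp add: zero_le_mult_iff) arith
    then have "0 \<le> (of_int (n * (n - 1)) :: rat)"
      by (simp only: of_int_0_le_iff)
    also have "\<dots> = (a - b + s) * (a - b + s - 1)"
      by (simp add: n)
    finally show ?thesis
      by (simp add: t_def c_def algebra_simps power2_eq_square)
  qed
  have step: "x (Suc i) - x i + s \<in> \<int>" if "i \<in> {1..8}" for i
  proof -
    have "f (Suc i) - f i \<in> \<int>"
      using that by (intro Ints_diff f) auto
    then show ?thesis
      by (simp add: f_def algebra_simps)
  qed
  have bounds: "t * x j - t * x i + c \<le> (x j - x i) * (x j - x i)"
    if "i \<in> {1..8}" "j = Suc i" for i j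
    using bound[OF step[OF that(1)]] by (simp only: that(2))
  have first: "x 1 + s \<in> \<int>"
    using f[of 1] by (simp add: f_def)
  \<comment> \<open>The tenth difference is 0 - \<open>x 9\<close>; its integrality after adding
    \<open>s\<close> uses 10 s = k.\<close>
  have "- f 9 + of_int k = - x 9 + s"
    by (simp add: s_def f_def)
  moreover have "- f 9 + of_int k \<in> \<int>"
    using f[of 9] by (intro Ints_add Ints_minus Ints_of_int) simp
  ultimately have last: "- x 9 + s \<in> \<int>"
    by simp
  have "t * x 1 + c \<le> x 1 * x 1" "- (t * x 9) + c \<le> x 9 * x 9"
    using bound[of "x 1" 0] first bound[of 0 "x 9"] last by simp_all
  moreover have "t * x 2 - t * x 1 + c \<le> (x 2 - x 1) * (x 2 - x 1)"
    "t * x 3 - t * x 2 + c \<le> (x 3 - x 2) * (x 3 - x 2)"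
    "t * x 4 - t * x 3 + c \<le> (x 4 - x 3) * (x 4 - x 3)"
    "t * x 5 - t * x 4 + c \<le> (x 5 - x 4) * (x 5 - x 4)"
    "t * x 6 - t * x 5 + c \<le> (x 6 - x 5) * (x 6 - x 5)"
    "t * x 7 - t * x 6 + c \<le> (x 7 - x 6) * (x 7 - x 6)"
    "t * x 8 - t * x 7 + c \<le> (x 8 - x 7) * (x 8 - x 7)"
    "t * x 9 - t * x 8 + c \<le> (x 9 - x 8) * (x 9 - x 8)"
    by (rule bounds; simp)+
  ultimately have "10 * c \<le> - A_form 9 x x"
    unfolding A9_form_eq by linarith
  then show ?thesis
    by (simp add: c_def t_def s_def power2_eq_square field_simps)
qed

text \<open>Equality holds for the multiples of \<open>perp_vec\<close> (defined next), which spans the orthogonal complement of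
  \<open>\<langle>a\<^sub>1, a\<^sub>3, \<dots>, a\<^sub>9\<rangle>\<close> in \<open>A\<^sub>9 \<otimes> \<rat>\<close>.\<close>

lemma A9_norm_ge_of_orth_a1:
  assumes "x 1 = m / 5" "x 2 = 2 * m / 5"
  shows "m\<^sup>2 / 10 \<le> - A_form 9 x x"
proof -
  \<comment> \<open>The eight differences from \<open>x 2\<close> down to the final 0 sum to -2m/5,
    so their mean is -m/20, and these are their squared deviations from it.\<close>
  have "0 \<le> (x 3 - x 2 + m / 20)\<^sup>2 + (x 4 - x 3 + m / 20)\<^sup>2 + (x 5 - x 4 + m / 20)\<^sup>2
     + (x 6 - x 5 + m / 20)\<^sup>2 + (x 7 - x 6 + m / 20)\<^sup>2 + (x 8 - x 7 + m / 20)\<^sup>2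
     + (x 9 - x 8 + m / 20)\<^sup>2 + (- x 9 + m / 20)\<^sup>2"
    by simp
  also have "\<dots> = - A_form 9 x x - m\<^sup>2 / 10"
    unfolding A9_form_eq assms by (simp add: field_simps power2_eq_square)
  finally show ?thesis by simp
qed

definition perp_vec :: qvec where
  "perp_vec = (\<lambda>i. if i \<in> {1..9} then if i = 1 then 1/5 else (10 - of_nat i) / 20 else 0)"

section \<open>Integral spans\<close>

lemma int_span_incl: "v \<in> S \<Longrightarrow> v \<in> int_span S"
  unfolding int_span_def by (rule generate.incl)

lemma int_span_0: "0 \<in> int_span S"
  using generate.one[of "add_grp UNIV" S] by (simp add: int_span_def add_grp_def)

lemma int_span_add: "v \<in> int_span S \<Longrightarrow> w \<in> int_span S \<Longrightarrow> v + w \<in> int_span S"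
  using generate.eng[of v "add_grp UNIV" S w] by (simp add: int_span_def add_grp_def)

definition add_subgroup :: "'v::ab_group_add set \<Rightarrow> bool" where
  "add_subgroup S \<longleftrightarrow> 0 \<in> S \<and> (\<forall>x\<in>S. \<forall>y\<in>S. x + y \<in> S) \<and> (\<forall>x\<in>S. - x \<in> S)"

lemma comm_group_add_grp:
  assumes "add_subgroup S"
  shows "comm_group (add_grp S)"
proof (rule comm_groupI)
  fix x assume "x \<in> carrier (add_grp S)"
  then show "\<exists>y\<in>carrier (add_grp S). y \<otimes>\<^bsub>add_grp S\<^esub> x = \<one>\<^bsub>add_grp S\<^esub>"
    using assms by (intro bexI[of _ "- x"]) (auto simp: add_grp_def add_subgroup_def)
qed (use assms in \<open>auto simp: add_grp_def add_subgroup_def ac_simps\<close>)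

lemma add_grp_simps [simp]:
  "carrier (add_grp S) = S" "x \<otimes>\<^bsub>add_grp S\<^esub> y = x + y" "\<one>\<^bsub>add_grp S\<^esub> = 0"
  by (simp_all add: add_grp_def)

lemma inv_add_grp:
  assumes "add_subgroup S" "x \<in> S"
  shows "inv\<^bsub>add_grp S\<^esub> x = - x"
proof -
  interpret comm_group "add_grp S"
    by (rule comm_group_add_grp) fact
  show ?thesis
    using assms by (intro inv_equality) (auto simp: add_subgroup_def)
qed

lemma add_subgroup_UNIV: "add_subgroup UNIV"
  by (simp add: add_subgroup_def)

lemma subgroup_add_grp:
  assumes "add_subgroup S" "add_subgroup T" "T \<subseteq> S"
  shows "subgroup T (add_grp S)"
  using assms by unfold_locales (auto simp: add_subgroup_def inv_add_grp subset_eq)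

lemma int_span_subset:
  assumes "add_subgroup T" "S \<subseteq> T"
  shows "int_span S \<subseteq> T"
proof -
  interpret comm_group "add_grp UNIV :: 'a monoid"
    by (rule comm_group_add_grp[OF add_subgroup_UNIV])
  show ?thesis
    unfolding int_span_def using assms
    by (intro generate_subgroup_incl subgroup_add_grp add_subgroup_UNIV) auto
qed

lemma add_subgroup_int_span: "add_subgroup (int_span S)"
proof -
  interpret comm_group "add_grp UNIV :: 'a monoid"
    by (rule comm_group_add_grp[OF add_subgroup_UNIV])
  have "- x \<in> int_span S" if "x \<in> int_span S" for x
    using generate_m_inv_closed[of S x] that
    by (simp add: int_span_def inv_add_grp add_subgroup_UNIV)
  then show ?thesis
    by (auto simp: add_subgroup_def int_span_0 int_span_add)
qed

lemma add_subgroupD: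
  assumes "add_subgroup S"
  shows "0 \<in> S" "x \<in> S \<Longrightarrow> y \<in> S \<Longrightarrow> x + y \<in> S" "x \<in> S \<Longrightarrow> - x \<in> S"
  using assms by (auto simp: add_subgroup_def)

text \<open>An additive \<open>f\<close> on the integers stands for the multiples of
  \<open>f 1\<close>, so that no scalar action on the target group has to be introduced.\<close>

lemma add_subgroup_zmult_mem:
  fixes f :: "int \<Rightarrow> 'v::ab_group_add"
  assumes S: "add_subgroup S" and f: "\<And>i j. f (i + j) = f i + f j" and "f 1 \<in> S"
  shows "f k \<in> S"
proof (induction k rule: int_induct[where k = 0])
  case base
  have "f 0 = 0"
    using f[of 0 0] by simp
  then show ?case
    using add_subgroupD(1)[OF S] by simp
next
  case (step1 i)
  then show ?case
    using add_subgroupD(2)[OF S step1.IH \<open>f 1 \<in> S\<close>] by (simp add: f)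
next
  case (step2 i)
  have "f (i - 1) = f i + - f 1"
    using f[of "i - 1" 1] by simp
  then show ?case
    using add_subgroupD(2)[OF S step2.IH add_subgroupD(3)[OF S \<open>f 1 \<in> S\<close>]] by simp
qed

text \<open>Induction on the support: one coordinate at a time is split off as an integer multiple
  of a simple root. The map \<open>f\<close> allows use in each summand of
  \<open>ambient\<close>.\<close>

lemma add_subgroup_int_combination:
  fixes f :: "qvec \<Rightarrow> 'v::ab_group_add"
  assumes S: "add_subgroup S" and f: "\<And>x y. f (x + y) = f x + f y"
    and I: "finite I" "\<And>i. i \<in> I \<Longrightarrow> f (simple_root i) \<in> S"
    and x: "\<And>i. x i \<in> \<int>" "\<And>i. i \<notin> I \<Longrightarrow> x i = 0"
  shows "f x \<in> S"
  using I x
proof (induction I arbitrary: x)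
  case empty
  have "x = 0"
    using empty(3) by (auto simp: fun_eq_iff)
  then have "f x = 0"
    using f[of 0 0] by (simp only: add_0_right add_cancel_right_right)
  then show ?case
    using add_subgroupD(1)[OF S] by (simp only:)
next
  case (insert i I)
  obtain k where k: "x i = of_int k"
    using insert.prems(2)[of i] by (rule Ints_cases)
  have "x(i := 0) + scale (of_int k) (simple_root i) = x"
    by (auto simp: scale_def simple_root_def k)
  moreover have "f (x(i := 0)) \<in> S"
  proof (rule insert.IH)
    show "f (simple_root j) \<in> S" if "j \<in> I" for j
      using that by (intro insert.prems(1)) simp
    show "(x(i := 0)) j \<in> \<int>" for j
      using insert.prems(2)[of j] by simp
    show "(x(i := 0)) j = 0" if "j \<notin> I" for j
      using insert.prems(3)[of j] that by simp
  qed
  moreover have "f (scale (of_int k) (simple_root i)) \<in> S"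
  proof (rule add_subgroup_zmult_mem[OF S])
    show "f (scale (of_int (a + b)) (simple_root i)) =
        f (scale (of_int a) (simple_root i)) + f (scale (of_int b) (simple_root i))" for a b
      unfolding f[symmetric] by (rule arg_cong[of _ _ f]) (simp add: scale_def fun_eq_iff algebra_simps)
    have "scale (of_int 1) (simple_root i) = simple_root i"
      by (simp add: scale_def)
    then show "f (scale (of_int 1) (simple_root i)) \<in> S"
      using insert.prems(1)[of i] by simp
  qed
  ultimately show ?case
    using add_subgroupD(2)[OF S] f by metis
qed

section \<open>The frame\<close>

text \<open>The class b[1] + c[3] of D_6^*/D_6. It depends only on the parities of b and c, but
  integer indices make it additive together with the classes of A_9.\<close>

definition D6_coset :: "int \<Rightarrow> int \<Rightarrow> qvec set" where
  "D6_coset b c = {r + scale (of_int b) delta6 + scale (of_int c) delta6' | r. r \<in> root_lattice 6}"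

lemma root_lattice_0: "0 \<in> root_lattice n"
  by (simp add: root_lattice_def rat_space_def)

lemma root_lattice_add: "x \<in> root_lattice n \<Longrightarrow> y \<in> root_lattice n \<Longrightarrow> x + y \<in> root_lattice n"
  by (simp add: root_lattice_def rat_space_def)

lemma root_lattice_uminus: "x \<in> root_lattice n \<Longrightarrow> - x \<in> root_lattice n"
  by (simp add: root_lattice_def rat_space_def)

lemma D6_coset_add:
  assumes "z \<in> D6_coset b c" "w \<in> D6_coset b' c'"
  shows "z + w \<in> D6_coset (b + b') (c + c')"
proof -
  obtain r s where "r \<in> root_lattice 6" "s \<in> root_lattice 6"
    and "z = r + scale (of_int b) delta6 + scale (of_int c) delta6'"
    and "w = s + scale (of_int b') delta6 + scale (of_int c') delta6'"
    using assms by (auto simp: D6_coset_def)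
  then show ?thesis
    unfolding D6_coset_def
    by (intro CollectI exI[of _ "r + s"])
      (auto simp: root_lattice_add scale_def fun_eq_iff algebra_simps)
qed

lemma D6_coset_uminus:
  assumes "z \<in> D6_coset b c"
  shows "- z \<in> D6_coset (- b) (- c)"
proof -
  obtain r where "r \<in> root_lattice 6"
    and "z = r + scale (of_int b) delta6 + scale (of_int c) delta6'"
    using assms by (auto simp: D6_coset_def)
  then show ?thesis
    unfolding D6_coset_def
    by (intro CollectI exI[of _ "- r"])
      (auto simp: root_lattice_uminus scale_def fun_eq_iff algebra_simps)
qed

lemma D6_coset_0: "z \<in> root_lattice 6 \<Longrightarrow> z \<in> D6_coset 0 0"
  unfolding D6_coset_def by (intro CollectI exI[of _ z]) (simp add: scale_def fun_eq_iff)

text \<open>The union of the cosets a[2,4,0] + b[5,0,1] + c[0,5,3], an explicit upper bound for the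
  lattice generated by the glue.\<close>

definition glue_classes :: "ambient set" where
  "glue_classes = {(x, y, z). \<exists>a b c.
     x \<in> A9_coset (2 * a + 5 * b) \<and> y \<in> A9_coset (4 * a + 5 * c) \<and> z \<in> D6_coset b c}"

lemma glue_classesI:
  "x \<in> A9_coset k \<Longrightarrow> y \<in> A9_coset l \<Longrightarrow> z \<in> D6_coset b c \<Longrightarrow>
    k = 2 * a + 5 * b \<Longrightarrow> l = 4 * a + 5 * c \<Longrightarrow> (x, y, z) \<in> glue_classes"
  by (auto simp: glue_classes_def)

lemma glue_classesE:
  assumes "v \<in> glue_classes"
  obtains x y z a b c where "v = (x, y, z)" "x \<in> A9_coset (2 * a + 5 * b)"
    "y \<in> A9_coset (4 * a + 5 * c)" "z \<in> D6_coset b c"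
  using assms by (auto simp: glue_classes_def)

lemma add_subgroup_glue_classes: "add_subgroup glue_classes"
  unfolding add_subgroup_def
proof (intro conjI ballI)
  have "(0, 0, 0) \<in> glue_classes"
    by (rule glue_classesI[where a = 0 and b = 0 and c = 0 and k = 0 and l = 0])
      (auto simp: A9_coset_0 D6_coset_0 root_lattice_0)
  then show "0 \<in> glue_classes"
    by (simp add: zero_prod_def)
next
  fix v w assume "v \<in> glue_classes" "w \<in> glue_classes"
  then obtain x y z a b c x' y' z' a' b' c' where
    "v = (x, y, z)" "x \<in> A9_coset (2 * a + 5 * b)"
    "y \<in> A9_coset (4 * a + 5 * c)" "z \<in> D6_coset b c"
    "w = (x', y', z')" "x' \<in> A9_coset (2 * a' + 5 * b')"
    "y' \<in> A9_coset (4 * a' + 5 * c')" "z' \<in> D6_coset b' c'"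
    by (elim glue_classesE)
  then show "v + w \<in> glue_classes"
    by (auto intro!: glue_classesI[where a = "a + a'"] A9_coset_add D6_coset_add)
next
  fix v assume "v \<in> glue_classes"
  then obtain x y z a b c where
    "v = (x, y, z)" "x \<in> A9_coset (2 * a + 5 * b)"
    "y \<in> A9_coset (4 * a + 5 * c)" "z \<in> D6_coset b c"
    by (elim glue_classesE)
  then show "- v \<in> glue_classes"
    by (auto intro!: glue_classesI[where a = "- a"] A9_coset_uminus D6_coset_uminus)
qed

lemma glue_coset_eq:
  "glue_coset i j d = {(x + scale (of_nat i) alpha, y + scale (of_nat j) alpha, z + d) | x y z.
     x \<in> root_lattice 9 \<and> y \<in> root_lattice 9 \<and> z \<in> root_lattice 6}"
  by (force simp: glue_coset_def r_coset_def L_root_def)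

lemma Niemeier_subset: "Niemeier_A9A9D6 \<subseteq> glue_classes"
  unfolding Niemeier_A9A9D6_def
proof (rule int_span_subset[OF add_subgroup_glue_classes], intro Un_least subsetI)
  fix v assume "v \<in> L_root"
  then show "v \<in> glue_classes"
    by (auto simp: L_root_def A9_coset_0 D6_coset_0
        intro!: glue_classesI[where a = 0 and b = 0 and c = 0 and k = 0 and l = 0])
next
  have *: "x + scale (of_nat i) alpha \<in> A9_coset (int i)" if "x \<in> root_lattice 9" for x i
    using A9_coset_add[of x 0, OF _ scale_alpha_coset[of "int i"]] that by (simp add: A9_coset_0)
  have delta: "z + 0 \<in> D6_coset 0 0" "z + delta6 \<in> D6_coset 1 0" "z + delta6' \<in> D6_coset 0 1"
    if "z \<in> root_lattice 6" for z
    using that unfolding D6_coset_def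
    by (auto intro!: exI[of _ z] simp: scale_def fun_eq_iff)
  fix v
  {
    assume "v \<in> glue_coset 2 4 0"
    then show "v \<in> glue_classes"
      using delta(1) by (auto simp: glue_coset_eq
        intro!: glue_classesI[OF *[of _ 2, simplified] *[of _ 4, simplified], where a = 1 and b = 0 and c = 0])
  next
    assume "v \<in> glue_coset 5 0 delta6"
    then show "v \<in> glue_classes"
      using delta(2) *[of _ 0] by (auto simp: glue_coset_eq
        intro!: glue_classesI[OF *[of _ 5, simplified] *[of _ 0, simplified], where a = 0 and b = 1 and c = 0])
  next
    assume "v \<in> glue_coset 0 5 delta6'"
    then show "v \<in> glue_classes"
      using delta(3) by (auto simp: glue_coset_eq
        intro!: glue_classesI[OF *[of _ 0, simplified] *[of _ 5, simplified], where a = 0 and b = 0 and c = 1])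
  }
qed

section \<open>The complement of the embedded lattice and its integral coordinates\<close>

lemma emb_apply:
  "emb (x', y') = ((\<lambda>i. if i = 1 then y' 1 else 0), 0,
     (\<lambda>i. if i = 6 then x' 1 else if i = 4 then x' 2 else if i = 3 then x' 3
       else if i = 2 then x' 4 else if i = 1 then x' 5 else 0))"
proof -
  have "{1..5::nat} = {1, 2, 3, 4, 5}" by auto
  then show ?thesis
    by (auto simp: emb_def root_embedding_def fun_eq_iff scale_def simple_root_def) (simp_all add: eval_nat_numeral)
qed

text \<open>Orthogonality to a_1 is the first equation. Orthogonality to d_1, d_2, d_3, d_4, d_6
  leaves the line of \<open>delta6'\<close> in D_6, parametrised by \<open>z 2\<close> because
  \<open>delta6'\<close> has second coordinate 1.\<close>

lemma orth_emb_iff: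
  "(\<forall>v\<in>emb ` (root_lattice 5 \<times> root_lattice 1). L_form (x, y, z) v = 0) \<longleftrightarrow>
     x 2 = 2 * x 1 \<and> z 1 = z 2 / 2 \<and> z 3 = 3 * z 2 / 2 \<and> z 4 = 2 * z 2 \<and> z 5 = 3 * z 2 / 2 \<and> z 6 = z 2"
  (is "?L \<longleftrightarrow> ?R")
proof
  assume L: ?L
  have r: "simple_root k \<in> root_lattice n" if "k \<in> {1..n}" for k n
    using that by (auto simp: root_lattice_def rat_space_def simple_root_def)
  have "L_form (x, y, z) (emb (0, simple_root 1)) = 0"
    by (intro bspec[OF L] imageI) (auto simp: root_lattice_0 intro!: r)
  then have x: "x 2 = 2 * x 1"
    by (simp add: emb_apply A9_form_eq D6_form_eq simple_root_def)
  have "L_form (x, y, z) (emb (simple_root k, 0)) = 0" if "k \<in> {1..5}" for k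
    using that by (intro bspec[OF L] imageI) (auto simp: root_lattice_0 intro!: r)
  then have "\<forall>k\<in>{1,2,3,4,5}. L_form (x, y, z) (emb (simple_root k, 0)) = 0"
    by simp
  then show ?R
    using x by (simp add: emb_apply A9_form_eq D6_form_eq simple_root_def)
next
  assume ?R
  then have eqs: "x 2 = 2 * x 1" "z 2 = 2 * z 1" "z 3 = 3 * z 1" "z 4 = 4 * z 1" "z 5 = 3 * z 1"
    "z 6 = 2 * z 1"
    by simp_all
  show ?L
    by (auto simp: emb_apply A9_form_eq D6_form_eq eqs algebra_simps)
qed

text \<open>The fibre over \<open>(m, c)\<close> of the coordinate map \<open>W \<rightarrow> \<int>\<^sup>2\<close>.\<close>

definition frame_fibre :: "int \<times> int \<Rightarrow> ambient set" where
  "frame_fibre = (\<lambda>(m, c). {(x, y, z). x \<in> A9_coset (- 2 * m) \<and> x 1 = of_int m / 5 \<and>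
     x 2 = 2 * of_int m / 5 \<and> y \<in> A9_coset (5 * c - 4 * m) \<and> z = scale (of_int c) delta6'})"

lemma frame_fibre_iff:
  "(x, y, z) \<in> frame_fibre (m, c) \<longleftrightarrow> x \<in> A9_coset (- 2 * m) \<and> x 1 = of_int m / 5 \<and>
     x 2 = 2 * of_int m / 5 \<and> y \<in> A9_coset (5 * c - 4 * m) \<and> z = scale (of_int c) delta6'"
  by (simp add: frame_fibre_def)

lemma frame_fibre_coords:
  assumes "(x, y, z) \<in> frame_fibre (m, c)"
  shows "x 1 = of_int m / 5" "x 2 = 2 * of_int m / 5" "z 2 = of_int c"
proof -
  have "z = scale (of_int c) delta6'"
    using assms unfolding frame_fibre_iff by blast
  then show "z 2 = of_int c"
    by (simp only: scale_def delta6'_apply) simp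
qed (use assms in \<open>simp_all add: frame_fibre_iff\<close>)

text \<open>The indices can be read off the vector, as m = 5 \<open>x 1\<close> and c =
  \<open>z 2\<close>.\<close>

lemma frame_fibre_unique:
  assumes "v \<in> frame_fibre p" "v \<in> frame_fibre q"
  shows "p = q"
proof -
  obtain x y z m c m' c' where v: "v = (x, y, z)" "p = (m, c)" "q = (m', c')"
    by (metis prod.exhaust)
  show ?thesis
    using frame_fibre_coords[OF assms(1)[unfolded v]] frame_fibre_coords[OF assms(2)[unfolded v]]
    by (simp add: v)
qed

lemma frame_fibre_add:
  assumes "v \<in> frame_fibre p" "w \<in> frame_fibre q"
  shows "v + w \<in> frame_fibre (p + q)"
proof -
  obtain x y z m c x' y' z' m' c' where
    v: "v = (x, y, z)" "p = (m, c)" "w = (x', y', z')" "q = (m', c')"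
    by (metis prod.exhaust)
  have "x + x' \<in> A9_coset (- 2 * m + - 2 * m')" "y + y' \<in> A9_coset ((5 * c - 4 * m) + (5 * c' - 4 * m'))"
    using assms unfolding v frame_fibre_iff by (blast intro: A9_coset_add)+
  moreover have "- 2 * m + - 2 * m' = - 2 * (m + m')"
    "(5 * c - 4 * m) + (5 * c' - 4 * m') = 5 * (c + c') - 4 * (m + m')"
    by simp_all
  ultimately have "x + x' \<in> A9_coset (- 2 * (m + m'))"
    "y + y' \<in> A9_coset (5 * (c + c') - 4 * (m + m'))"
    by simp_all
  moreover have "(x + x') 1 = of_int (m + m') / 5" "(x + x') 2 = 2 * of_int (m + m') / 5"
    "z + z' = scale (of_int (c + c')) delta6'"
    using assms by (auto simp: v frame_fibre_iff scale_def fun_eq_iff field_simps)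
  ultimately have "(x + x', y + y', z + z') \<in> frame_fibre (m + m', c + c')"
    by (simp only: frame_fibre_iff simp_thms)
  then show ?thesis
    by (simp add: v)
qed

lemma frame_fibre_uminus:
  assumes "v \<in> frame_fibre p"
  shows "- v \<in> frame_fibre (- p)"
proof -
  obtain x y z m c where v: "v = (x, y, z)" "p = (m, c)"
    by (metis prod.exhaust)
  have "- x \<in> A9_coset (- (- 2 * m))" "- y \<in> A9_coset (- (5 * c - 4 * m))"
    using assms unfolding v frame_fibre_iff by (blast intro: A9_coset_uminus)+
  moreover have "- (- 2 * m) = - 2 * (- m)" "- (5 * c - 4 * m) = 5 * (- c) - 4 * (- m)"
    by simp_all
  ultimately have "- x \<in> A9_coset (- 2 * (- m))" "- y \<in> A9_coset (5 * (- c) - 4 * (- m))"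
    by (simp_all only:)
  moreover have "(- x) 1 = of_int (- m) / 5" "(- x) 2 = 2 * of_int (- m) / 5"
    "- z = scale (of_int (- c)) delta6'"
    using assms by (auto simp: v frame_fibre_iff scale_def fun_eq_iff field_simps)
  ultimately have "(- x, - y, - z) \<in> frame_fibre (- m, - c)"
    by (simp only: frame_fibre_iff simp_thms)
  then show ?thesis
    by (simp add: v)
qed

lemma frame_fibre_nonempty: "\<exists>v. v \<in> frame_fibre p"
proof -
  obtain m c where p: "p = (m, c)"
    by (metis prod.exhaust)
  \<comment> \<open>The linear values m i / 5 have the right first two coordinates and the right
    class; the value 4m/5 at index 9 differs from 9m/5 by the integer m.\<close>
  define x :: qvec where "x = (\<lambda>i. if i \<in> {1..8} then of_int m * of_nat i / 5 else if i = 9 then 4 * of_int m / 5 else 0)"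
  have "x i + of_int (- 2 * m) * of_nat i / 10 = (if i = 9 then of_int (- m) else 0)"
    if "i \<in> {1..9}" for i
    using that by (auto simp: x_def)
  then have "x \<in> A9_coset (- 2 * m)"
    unfolding A9_coset_def by (auto simp: rat_space_def) (auto simp: x_def)
  then have "(x, scale (of_int (5 * c - 4 * m)) alpha, scale (of_int c) delta6') \<in> frame_fibre (m, c)"
    unfolding frame_fibre_iff using scale_alpha_coset[of "5 * c - 4 * m"] by (simp add: x_def)
  then show ?thesis
    unfolding p by blast
qed

text \<open>As z lies on the line of \<open>delta6'\<close>, comparing \<open>z 6\<close> with
  \<open>z 2\<close> makes b even. Then \<open>z 2\<close> is an integer with the parity of c, and 5
  \<open>x 1\<close> is an integer m with -2m congruent to 2a + 5b modulo 10; these two numbers also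
  determine the class of y.\<close>

lemma glue_classes_orth_imp_frame_fibre:
  assumes "(x, y, z) \<in> glue_classes"
    and orth: "x 2 = 2 * x 1" "z 1 = z 2 / 2" "z 3 = 3 * z 2 / 2" "z 4 = 2 * z 2" "z 5 = 3 * z 2 / 2"
      "z 6 = z 2"
  shows "\<exists>p. (x, y, z) \<in> frame_fibre p"
proof -
  obtain a b c r where x: "x \<in> A9_coset (2 * a + 5 * b)" and y: "y \<in> A9_coset (4 * a + 5 * c)"
    and r: "r \<in> root_lattice 6" "z = r + scale (of_int b) delta6 + scale (of_int c) delta6'"
    using assms(1) unfolding glue_classes_def D6_coset_def by blast
  have "r i \<in> \<int>" for i
    using r(1) by (simp add: root_lattice_def)
  then have "\<exists>n. r i = of_int n" for i
    by (metis Ints_cases)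
  then obtain r' where r': "r i = of_int (r' i)" for i
    by metis
  have z: "z 1 = of_int (r' 1) + of_int b / 2 + of_int c / 2" "z 2 = of_int (r' 2 + b + c)"
    "z 6 = of_int (r' 6) + 3 * of_int b / 2 + of_int c"
    by (simp_all add: r(2) r' scale_def delta6_apply delta6'_apply)
  \<comment> \<open>The equation \<open>z 6 = z 2\<close> says that b/2 is this integer.\<close>
  define b' where "b' = r' 2 - r' 6"
  have "of_int b = (of_int (2 * b') :: rat)"
    using z orth by (simp add: b'_def field_simps)
  then have b: "b = 2 * b'"
    by (simp only: of_int_eq_iff)
  define c' where "c' = r' 2 + b + c"
  have "of_int c' = (of_int (2 * r' 1 + b + c) :: rat)"
    using z orth by (simp add: c'_def field_simps)
  then have c': "c' = 2 * r' 1 + 2 * b' + c"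
    by (simp only: of_int_eq_iff b)
  obtain n where n: "x 1 + of_int (2 * a + 5 * b) * of_nat 1 / 10 = of_int n"
    using A9_cosetD[OF x, of 1] by (metis Ints_cases atLeastAtMost_iff order_refl one_le_numeral)
  \<comment> \<open>This is 5 \<open>x 1\<close>, since \<open>x 1\<close> = n - (2a +
    10b')/10.\<close>
  define m where "m = 5 * n - a - 5 * b'"
  have x1: "x 1 = of_int m / 5"
    using n by (simp add: m_def b field_simps)
  have "x \<in> A9_coset (- 2 * m)"
  proof (rule A9_coset_mod[OF x])
    have "- 2 * m = (2 * a + 5 * b) + 10 * (- n)"
      by (simp add: m_def b)
    then show "(2 * a + 5 * b) mod 10 = (- 2 * m) mod 10"
      by (metis mod_mult_self2)
  qed
  moreover have "y \<in> A9_coset (5 * c' - 4 * m)"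
  proof (rule A9_coset_mod[OF y])
    have "5 * c' - 4 * m = (4 * a + 5 * c) + 10 * (r' 1 + 3 * b' - 2 * n)"
      by (simp add: m_def c')
    then show "(4 * a + 5 * c) mod 10 = (5 * c' - 4 * m) mod 10"
      by (metis mod_mult_self2)
  qed
  moreover have "z = scale (of_int c') delta6'"
  proof
    fix i
    show "z i = scale (of_int c') delta6' i"
    proof (cases "i \<in> {1..6}")
      case True
      have "\<forall>i\<in>{1,2,3,4,5,6}. z i = scale (of_int c') delta6' i"
        using z(2) orth by (simp add: scale_def delta6'_apply c'_def)
      then show ?thesis
        using True unfolding interval_1_6 by blast
    next
      case False
      then have "i \<noteq> 1" "i \<noteq> 2" "i \<noteq> 3" "i \<noteq> 4" "i \<noteq> 5" "i \<noteq> 6" by auto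
      then show ?thesis
        using r(1) False by (simp add: r(2) root_lattice_def rat_space_def scale_def delta6_apply delta6'_apply)
    qed
  qed
  moreover have "x 2 = 2 * of_int m / 5"
    using orth(1) x1 by simp
  ultimately have "(x, y, z) \<in> frame_fibre (m, c')"
    using x1 by (simp only: frame_fibre_iff simp_thms)
  then show ?thesis
    by blast
qed

text \<open>Modulo \<open>L_root\<close> a vector over (m, c) equals -m[2,4,0] + c[0,5,3], so it is
  an integral combination of generators.\<close>

lemma frame_fibre_subset_Niemeier: "frame_fibre p \<subseteq> Niemeier_A9A9D6"
proof
  fix v assume v: "v \<in> frame_fibre p"
  obtain x y z m c where [simp]: "v = (x, y, z)" "p = (m, c)"
    by (metis prod.exhaust)
  note N = add_subgroup_int_span[of "L_root \<union> glue_coset 2 4 0 \<union> glue_coset 5 0 delta6 \<union> glue_coset 0 5 delta6'",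
    folded Niemeier_A9A9D6_def]
  have gen: "w \<in> Niemeier_A9A9D6" if "w \<in> L_root \<union> glue_coset 2 4 0 \<union> glue_coset 0 5 delta6'" for w
    using that unfolding Niemeier_A9A9D6_def by (intro int_span_incl) blast
  have g: "(scale (of_nat i) alpha, scale (of_nat j) alpha, d) \<in> glue_coset i j d" for i j d
    unfolding glue_coset_eq by (intro CollectI exI[of _ 0]) (simp add: root_lattice_0)
  have "(scale (of_int k * 2) alpha, scale (of_int k * 4) alpha, 0) \<in> Niemeier_A9A9D6" for k
    using gen[OF UnI1, OF UnI2, OF g]
    by (intro add_subgroup_zmult_mem[OF N, of "\<lambda>k. (scale (of_int k * 2) alpha, scale (of_int k * 4) alpha, 0)" k])
      (auto simp: scale_def fun_eq_iff algebra_simps)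
  moreover have "(0, scale (of_int k * 5) alpha, scale (of_int k) delta6') \<in> Niemeier_A9A9D6" for k
  proof (rule add_subgroup_zmult_mem[OF N, of "\<lambda>k. (0, scale (of_int k * 5) alpha, scale (of_int k) delta6')" k])
    have "(0, scale (of_int 1 * 5) alpha, scale (of_int 1) delta6') = (scale (of_nat 0) alpha, scale (of_nat 5) alpha, delta6')"
      by (auto simp: scale_def fun_eq_iff)
    then show "(0, scale (of_int 1 * 5) alpha, scale (of_int 1) delta6') \<in> Niemeier_A9A9D6"
      using gen[OF UnI2, OF g] by simp
  qed (auto simp: scale_def fun_eq_iff algebra_simps)
  moreover have "(x + scale (of_int (2 * m)) alpha, y + scale (of_int (4 * m - 5 * c)) alpha, 0) \<in> Niemeier_A9A9D6"
  proof (rule gen)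
    have "x + scale (of_int (2 * m)) alpha \<in> A9_coset (- 2 * m + 2 * m)"
      "y + scale (of_int (4 * m - 5 * c)) alpha \<in> A9_coset ((5 * c - 4 * m) + (4 * m - 5 * c))"
      using v by (auto simp only: frame_fibre_iff \<open>v = _\<close> \<open>p = _\<close> intro!: A9_coset_add scale_alpha_coset)
    then show "(x + scale (of_int (2 * m)) alpha, y + scale (of_int (4 * m - 5 * c)) alpha, 0)
        \<in> L_root \<union> glue_coset 2 4 0 \<union> glue_coset 0 5 delta6'"
      by (simp add: A9_coset_0 L_root_def root_lattice_0)
  qed
  ultimately have "(x + scale (of_int (2 * m)) alpha, y + scale (of_int (4 * m - 5 * c)) alpha, 0)
      + ((scale (of_int (- m) * 2) alpha, scale (of_int (- m) * 4) alpha, 0)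
      + (0, scale (of_int c * 5) alpha, scale (of_int c) delta6')) \<in> Niemeier_A9A9D6"
    (is "?s \<in> _")
    by (intro add_subgroupD(2)[OF N])
  also have "?s = v"
  proof -
    have "z = scale (of_int c) delta6'"
      using v by (simp add: frame_fibre_iff)
    then show ?thesis
      by (simp add: scale_def fun_eq_iff algebra_simps)
  qed
  finally show "v \<in> Niemeier_A9A9D6" .
qed

lemma W_eq: "W = (\<Union>p. frame_fibre p)"
proof (intro subset_antisym subsetI)
  fix v assume v: "v \<in> W"
  obtain x y z where xyz: "v = (x, y, z)"
    by (metis prod.exhaust)
  show "v \<in> (\<Union>p. frame_fibre p)"
    using v glue_classes_orth_imp_frame_fibre[of x y z] Niemeier_subset
    unfolding W_def orth_in_def xyz mem_Collect_eq orth_emb_iff by auto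
next
  fix v assume "v \<in> (\<Union>p. frame_fibre p)"
  then obtain p where v: "v \<in> frame_fibre p"
    by blast
  obtain x y z m c where xyz: "v = (x, y, z)" "p = (m, c)"
    by (metis prod.exhaust)
  have "x 2 = 2 * x 1 \<and> z 1 = z 2 / 2 \<and> z 3 = 3 * z 2 / 2 \<and> z 4 = 2 * z 2 \<and> z 5 = 3 * z 2 / 2 \<and> z 6 = z 2"
    using v by (simp add: xyz frame_fibre_iff scale_def delta6'_apply)
  then show "v \<in> W"
    using v frame_fibre_subset_Niemeier[of p]
    unfolding W_def orth_in_def xyz mem_Collect_eq orth_emb_iff by blast
qed

section \<open>Roots and orthogonal projection\<close>

lemma frame_fibre_in_L_root:
  assumes "(x, y, z) \<in> frame_fibre (m, c)" "5 dvd m" "2 dvd c"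
  shows "(x, y, z) \<in> L_root"
proof -
  obtain m' c' where mc: "m = 5 * m'" "c = 2 * c'"
    using assms by (auto elim!: dvdE)
  have "x \<in> root_lattice 9"
    using assms(1) by (intro root_lattice_9_coset_mod[of _ "- 2 * m"]) (auto simp: frame_fibre_iff mc)
  moreover have "10 dvd 5 * c - 4 * m"
    by (intro dvdI[of _ _ "c' - 2 * m'"]) (simp add: mc)
  then have "y \<in> root_lattice 9"
    using assms(1) by (intro root_lattice_9_coset_mod[of _ "5 * c - 4 * m"]) (auto simp: frame_fibre_iff)
  moreover have "z = scale (of_int (2 * c')) delta6'"
    using assms(1) by (simp add: frame_fibre_iff mc)
  then have "z \<in> root_lattice 6"
    by (auto simp: root_lattice_def rat_space_def scale_def delta6'_apply)
  ultimately show ?thesis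
    by (simp add: L_root_def)
qed

text \<open>\<open>N\<close> is the intersection of \<open>W\<close> with \<open>L_root\<close>. On
  the fibre over (m, c) one has \<open>x 1\<close> = m/5 and \<open>z 1\<close> = c/2, whose
  integrality gives the divisibilities; conversely these make all three glue classes
  trivial.\<close>

lemma N_eq: "N = (\<Union>p\<in>{p. 5 dvd fst p \<and> 2 dvd snd p}. frame_fibre p)"
proof -
  have "L_root \<subseteq> Niemeier_A9A9D6"
    unfolding Niemeier_A9A9D6_def by (auto intro: int_span_incl)
  then have N: "N = W \<inter> L_root"
    unfolding N_def W_def orth_in_def by blast
  show ?thesis
  proof (intro subset_antisym subsetI)
    fix v assume "v \<in> N"
    then obtain x y z m c where v: "v = (x, y, z)" "v \<in> L_root" "v \<in> frame_fibre (m, c)"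
      unfolding N W_eq by (metis IntE UN_E prod.exhaust)
    have "x 1 \<in> \<int>" "z 1 \<in> \<int>"
      using v by (auto simp: L_root_def root_lattice_def)
    then obtain k l where "x 1 = of_int k" "z 1 = of_int l"
      by (metis Ints_cases)
    moreover have "z 1 = of_int c / 2"
    proof -
      have "z = scale (of_int c) delta6'"
        using v by (simp add: frame_fibre_iff)
      then show ?thesis
        by (simp only: scale_def delta6'_apply) simp
    qed
    ultimately have "of_int m = (of_int (5 * k) :: rat)" "of_int c = (of_int (2 * l) :: rat)"
      using frame_fibre_coords(1)[OF v(3)[unfolded v(1)]] by (simp_all add: field_simps)
    then have "m = 5 * k" "c = 2 * l"
      by (simp_all only: of_int_eq_iff)
    then show "v \<in> (\<Union>p\<in>{p. 5 dvd fst p \<and> 2 dvd snd p}. frame_fibre p)"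
      using v(3) by (intro UN_I[of "(m, c)"]) auto
  next
    fix v assume "v \<in> (\<Union>p\<in>{p. 5 dvd fst p \<and> 2 dvd snd p}. frame_fibre p)"
    then obtain p where p: "5 dvd fst p" "2 dvd snd p" "v \<in> frame_fibre p"
      by blast
    obtain x y z where "v = (x, y, z)"
      by (metis prod.exhaust)
    then have "v \<in> L_root"
      using p frame_fibre_in_L_root[of x y z "fst p" "snd p"] by simp
    moreover have "v \<in> W"
      unfolding W_eq using p(3) by blast
    ultimately show "v \<in> N"
      by (simp add: N)
  qed
qed

lemma frame_fibre_0_iff:
  "(x, y, z) \<in> frame_fibre 0 \<longleftrightarrow>
     x \<in> root_lattice 9 \<and> x 1 = 0 \<and> x 2 = 0 \<and> y \<in> root_lattice 9 \<and> z = 0"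
  unfolding zero_prod_def frame_fibre_iff by (auto simp: A9_coset_0 scale_def fun_eq_iff)

lemma add_subgroup_frame_fibre_0: "add_subgroup (frame_fibre 0)"
  unfolding add_subgroup_def
proof (intro conjI ballI)
  show "0 \<in> frame_fibre 0"
    unfolding zero_prod_def[where 'a = qvec] frame_fibre_0_iff by (simp add: root_lattice_0 zero_prod_def)
  show "v + w \<in> frame_fibre 0" if "v \<in> frame_fibre 0" "w \<in> frame_fibre 0" for v w
    using frame_fibre_add[OF that] by simp
  show "- v \<in> frame_fibre 0" if "v \<in> frame_fibre 0" for v
    using frame_fibre_uminus[OF that] by simp
qed

lemma A9_coset_norm_ge_mod:
  assumes "x \<in> A9_coset k" "k mod 10 = r mod 10"
  shows "of_int (r * (10 - r)) / 10 \<le> - A_form 9 x x"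
  by (rule A9_coset_norm_ge[OF A9_coset_mod[OF assms]])

lemma D6_form_delta6': "D6_form (scale a delta6') (scale b delta6') = - 3 * a * b / 2"
  by (simp add: D6_form_eq scale_def delta6'_apply)

text \<open>For a root the norms X, Y of the A_9 components satisfy X + Y + 3c^2/2 = 2. If c = 1 or
  c = -1, only 1/2 remains, while y is in an odd class and has norm at least 9/10. If c = 0 and m is
  not 0, the minimal norms of the two classes already add up to 4.\<close>

lemma frame_root_in_fibre_0:
  assumes v: "v \<in> W" and root: "L_form v v = -2"
  shows "v \<in> frame_fibre 0"
proof -
  obtain x y z m c where xyz: "v = (x, y, z)" and v': "(x, y, z) \<in> frame_fibre (m, c)"
    using v unfolding W_eq by (metis UN_E prod.exhaust)
  define X where "X = - A_form 9 x x"
  define Y where "Y = - A_form 9 y y"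
  have x: "x \<in> A9_coset (- 2 * m)" and y: "y \<in> A9_coset (5 * c - 4 * m)"
    and z: "z = scale (of_int c) delta6'"
    using v' by (simp_all add: frame_fibre_iff)
  have X: "0 \<le> X" "(of_int m)\<^sup>2 / 10 \<le> X"
    unfolding X_def using A9_norm_nonneg A9_norm_ge_of_orth_a1[OF frame_fibre_coords(1,2)[OF v']]
    by auto
  have Y: "0 \<le> Y"
    unfolding Y_def by (rule A9_norm_nonneg)
  have sum: "X + Y + 3 * (of_int c)\<^sup>2 / 2 = 2"
    using root by (simp add: xyz X_def Y_def z D6_form_delta6' power2_eq_square)
  \<comment> \<open>The bound m^2/10 <= X <= 2 excludes nonzero multiples of 5, for which, when c =
    0, both classes are trivial and the coset bound says nothing.\<close>
  have "(of_int (m\<^sup>2) :: rat) \<le> 20" "(of_int (c\<^sup>2) :: rat) < 4"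
    unfolding of_int_power using X Y sum zero_le_power2[of "of_int c :: rat"] by linarith+
  then have "m\<^sup>2 \<le> 20" "c\<^sup>2 < 4"
    by linarith+
  then have c: "\<bar>c\<bar> < 2" and m: "\<bar>m\<bar> < 5"
    using abs_square_less_1 power2_less_imp_less[of "\<bar>c\<bar>" 2] power2_less_imp_less[of "\<bar>m\<bar>" 5]
    by auto
  from m have m: "m \<in> {-4, -3, -2, -1, 0, 1, 2, 3, 4}"
    by auto
  \<comment> \<open>The coset bound k (10 - k) / 10 is nonnegative only for k from 0 to 10, so it is
    applied to residues.\<close>
  define r where "r = (- 2 * m) mod 10"
  define s where "s = (5 * c - 4 * m) mod 10"
  have Xr: "of_int (r * (10 - r)) / 10 \<le> X"
    unfolding X_def by (rule A9_coset_norm_ge_mod[OF x]) (simp add: r_def)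
  have Ys: "of_int (s * (10 - s)) / 10 \<le> Y"
    unfolding Y_def by (rule A9_coset_norm_ge_mod[OF y]) (simp add: s_def)
  have "c = 0"
  proof (rule ccontr)
    assume "c \<noteq> 0"
    with c have c1: "c = 1 \<or> c = -1" by linarith
    then have "X + Y = 1 / 2"
      using sum by auto
    moreover have "s \<in> {1, 3, 5, 7, 9}"
      using c1 m unfolding s_def by (elim disjE insertE emptyE) simp_all
    then have "9 / 10 \<le> Y"
      using Ys by (elim insertE emptyE) simp_all
    ultimately show False
      using X(1) by linarith
  qed
  have "m = 0"
  proof (rule ccontr)
    assume "m \<noteq> 0"
    then have "(r, s) \<in> {(2, 4), (4, 8), (6, 2), (8, 6)}"
      using m unfolding r_def s_def \<open>c = 0\<close> by (elim insertE emptyE) simp_all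
    then have "4 \<le> X + Y"
      using Xr Ys by auto
    then show False
      using sum \<open>c = 0\<close> by simp
  qed
  then show ?thesis
    using v' \<open>c = 0\<close> by (simp add: xyz zero_prod_def)
qed

lemma A9_form_simple_root: "i \<in> {1..9} \<Longrightarrow> A_form 9 (simple_root i) (simple_root i) = -2"
  unfolding interval_1_9 A9_form_eq simple_root_def by (elim insertE emptyE) simp_all

lemma simple_root_in_root_lattice: "i \<in> {1..n} \<Longrightarrow> simple_root i \<in> root_lattice n"
  by (auto simp: root_lattice_def rat_space_def simple_root_def)

lemma form_0 [simp]: "A_form 9 0 0 = 0" "D6_form 0 0 = 0"
  by (simp_all add: root_form_def)

text \<open>Serves for \<open>W\<close> and \<open>N\<close> at once. The roots lie in the zero
  fibre, which is spanned by the roots a_3, ..., a_9 and the simple roots of the second A_9.\<close>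

lemma root_part_eq_frame_fibre_0:
  assumes "frame_fibre 0 \<subseteq> S" "S \<subseteq> W"
  shows "root_part L_form S = frame_fibre 0"
proof (intro subset_antisym subsetI)
  let ?R = "{x \<in> S. L_form x x = -2}"
  have "?R \<subseteq> frame_fibre 0"
    using assms(2) frame_root_in_fibre_0 by blast
  then show "v \<in> frame_fibre 0" if "v \<in> root_part L_form S" for v
    using int_span_subset[OF add_subgroup_frame_fibre_0] that unfolding root_part_def by blast
  fix v assume v: "v \<in> frame_fibre 0"
  obtain x y z where xyz: "v = (x, y, z)"
    by (metis prod.exhaust)
  have xy: "x \<in> root_lattice 9" "x 1 = 0" "x 2 = 0" "y \<in> root_lattice 9" "z = 0"
    using v by (simp_all add: xyz frame_fibre_0_iff)
  have "(x, 0, 0) \<in> int_span ?R"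
  proof (rule add_subgroup_int_combination[OF add_subgroup_int_span, where I = "{3..9}" and f = "\<lambda>x. (x, 0, 0)"])
    fix i :: nat assume i: "i \<in> {3..9}"
    then have "(simple_root i, 0, 0) \<in> frame_fibre 0"
      using simple_root_in_root_lattice[of i 9]
      by (simp add: frame_fibre_0_iff root_lattice_0) (simp add: simple_root_def)
    then show "(simple_root i, 0, 0) \<in> int_span ?R"
      using assms(1) i by (intro int_span_incl) (auto simp: A9_form_simple_root)
  next
    fix i :: nat assume "i \<notin> {3..9}"
    then have "i = 1 \<or> i = 2 \<or> i \<notin> {1..9}" by auto
    then show "x i = 0"
      using xy by (auto simp: root_lattice_def rat_space_def)
  qed (use xy in \<open>auto simp: root_lattice_def\<close>)
  moreover have "(0, y, 0) \<in> int_span ?R"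
  proof (rule add_subgroup_int_combination[OF add_subgroup_int_span, where I = "{1..9}" and f = "\<lambda>y. (0, y, 0)"])
    fix i :: nat assume i: "i \<in> {1..9}"
    then have "(0, simple_root i, 0) \<in> frame_fibre 0"
      using simple_root_in_root_lattice[of i 9] by (simp add: frame_fibre_0_iff root_lattice_0)
    then show "(0, simple_root i, 0) \<in> int_span ?R"
      using assms(1) i by (intro int_span_incl) (auto simp: A9_form_simple_root)
  qed (use xy in \<open>auto simp: root_lattice_def rat_space_def\<close>)
  ultimately have "(x, 0, 0) + (0, y, 0) \<in> int_span ?R"
    by (rule int_span_add)
  then show "v \<in> root_part L_form S"
    by (simp add: root_part_def xyz xy)
qed

lemma W_root_eq: "W_root = frame_fibre 0"
  by (rule root_part_eq_frame_fibre_0) (auto simp: W_eq)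

lemma N_root_eq: "N_root = frame_fibre 0"
proof (rule root_part_eq_frame_fibre_0)
  show "frame_fibre 0 \<subseteq> N"
    unfolding N_eq by (rule UN_upper) simp
  show "N \<subseteq> W"
    unfolding N_eq W_eq by blast
qed

section \<open>Orthogonal projection and heights\<close>

text \<open>The squares of \<open>perp_vec\<close> and \<open>delta6'\<close> are -1/10 and -3/2;
  this is the origin of the form (x^2 + 15 y^2)/10.\<close>

lemma L_form_scale_perp:
  "L_form (scale a perp_vec, 0, scale b delta6') (scale a' perp_vec, 0, scale b' delta6')
     = - ((a * a' + 15 * b * b') / 10)"
  unfolding L_form_eq D6_form_delta6' form_0
  by (simp add: A9_form_eq scale_def perp_vec_def field_simps)

lemma ambient_nat_pow:
  "(x, y, z) [^]\<^bsub>add_grp UNIV\<^esub> (n :: nat) = (scale (of_nat n) x, scale (of_nat n) y, scale (of_nat n) z)"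
  by (induction n) (auto simp: nat_pow_def scale_def fun_eq_iff algebra_simps zero_prod_def)

lemma root_lattice_9I:
  assumes "x \<in> rat_space 9" "\<And>i. i \<in> {1..9} \<Longrightarrow> x i \<in> \<int>"
  shows "x \<in> root_lattice 9"
proof -
  have "x i \<in> \<int>" for i
    using assms by (cases "i \<in> {1..9}") (auto simp: rat_space_def)
  then show ?thesis
    using assms(1) by (simp add: root_lattice_def)
qed

text \<open>The first two coordinates of \<open>perp_vec\<close> are 1/5 and 2/5, so its m-fold
  agrees there with x, and the difference lies in the rational span of a_3, ..., a_9. The second
  component is projected to 0, and the third is already orthogonal to the zero fibre.\<close>

lemma orth_proj_frame_fibre:
  assumes "v \<in> frame_fibre (m, c)"
  shows "orth_proj L_form W_root v = (scale (of_int m) perp_vec, 0, scale (of_int c) delta6')"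
  unfolding orth_proj_def W_root_eq
proof (rule the_equality)
  obtain x y z where xyz: "v = (x, y, z)"
    by (metis prod.exhaust)
  have x: "x \<in> A9_coset (- 2 * m)" and y: "y \<in> A9_coset (5 * c - 4 * m)"
    and z: "z = scale (of_int c) delta6'" and x12: "x 1 = of_int m / 5" "x 2 = 2 * of_int m / 5"
    using assms by (simp_all add: xyz frame_fibre_iff)
  let ?x = "scale (of_int m) perp_vec"
  \<comment> \<open>From index 2 on \<open>perp_vec\<close> is linear and would reach 0 at index 10,
    so its products with a_3, ..., a_9, which are second differences, vanish.\<close>
  have orth: "A_form 9 ?x x' = 0" if "x' 1 = 0" "x' 2 = 0" for x'
    by (simp add: A9_form_eq scale_def perp_vec_def that[simplified] field_simps)
  have "L_form (?x, 0, z) w = 0" if "w \<in> frame_fibre 0" for w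
  proof -
    obtain x' y' z' where w: "w = (x', y', z')"
      by (metis prod.exhaust)
    have "x' 1 = 0" "x' 2 = 0" "z' = 0"
      using that by (simp_all add: w frame_fibre_0_iff)
    then show ?thesis
      by (simp add: w orth root_form_def[of _ _ _ "0 :: qvec"] root_form_def[of _ _ "0 :: qvec"])
  qed
  then have 1: "(?x, 0, scale (of_int c) delta6') \<in> orth_in L_form UNIV (frame_fibre 0)"
    by (simp add: orth_in_def z)
  \<comment> \<open>The factor 20 is a common denominator: 10 for elements of A_9^* and 20 for
    \<open>perp_vec\<close>.\<close>
  have int: "20 * (w i) \<in> \<int>" if w: "w \<in> A9_coset k" "i \<in> {1..9}" for w k i
  proof -
    obtain n where "w i + of_int k * of_nat i / 10 = of_int n"
      using A9_cosetD[OF w] by (metis Ints_cases)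
    then have "20 * w i = of_int (20 * n - 2 * k * int i)"
      by (simp add: field_simps)
    then show ?thesis
      by (metis Ints_of_int)
  qed
  have "20 * (x i - ?x i) \<in> \<int>" if "i \<in> {1..9}" for i
  proof -
    have "20 * ?x i = (if i = 1 then of_int (4 * m) else of_int (m * (10 - int i)))"
      using that by (auto simp: scale_def perp_vec_def)
    then have "20 * ?x i \<in> \<int>"
      by simp
    moreover have "20 * (x i - ?x i) = 20 * x i - 20 * ?x i"
      by (simp add: algebra_simps)
    ultimately show ?thesis
      using int[OF x that] by (simp only: Ints_diff)
  qed
  then have "scale 20 (x - ?x) \<in> root_lattice 9"
    using x by (intro root_lattice_9I) (auto simp: A9_coset_def rat_space_def scale_def perp_vec_def)
  moreover have "scale 20 y \<in> root_lattice 9"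
    using y int[OF y] by (intro root_lattice_9I) (auto simp: A9_coset_def rat_space_def scale_def)
  ultimately have "(scale 20 (x - ?x), scale 20 y, 0) \<in> frame_fibre 0"
    using x12 by (simp add: frame_fibre_0_iff) (simp add: scale_def perp_vec_def)
  moreover have "v - (?x, 0, scale (of_int c) delta6') = (x - ?x, y, 0)"
    by (simp add: xyz z)
  moreover have "scale 20 0 = 0"
    by (simp add: scale_def fun_eq_iff)
  ultimately have 2: "v - (?x, 0, scale (of_int c) delta6') \<in> rat_hull (frame_fibre 0)"
    unfolding rat_hull_def by (intro CollectI exI[of _ 20]) (simp add: ambient_nat_pow)
  show "(?x, 0, scale (of_int c) delta6') \<in> orth_in L_form UNIV (frame_fibre 0) \<and>
      v - (?x, 0, scale (of_int c) delta6') \<in> rat_hull (frame_fibre 0)"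
    using 1 2 by blast
  fix p assume p: "p \<in> orth_in L_form UNIV (frame_fibre 0) \<and> v - p \<in> rat_hull (frame_fibre 0)"
  obtain p1 p2 p3 where p_eq: "p = (p1, p2, p3)"
    by (metis prod.exhaust)
  obtain n :: nat where n: "n > 0" "(v - p) [^]\<^bsub>add_grp UNIV\<^esub> n \<in> frame_fibre 0"
    using p unfolding rat_hull_def by blast
  \<comment> \<open>Uniqueness: membership of v - p in the hull fixes the third component and the
    first two coordinates of p; orthogonality to the simple roots in the zero fibre fixes the
    rest.\<close>
  have "(scale (of_nat n) (x - p1), scale (of_nat n) (y - p2), scale (of_nat n) (z - p3)) \<in> frame_fibre 0"
    using n(2) by (simp add: xyz p_eq ambient_nat_pow)
  then have hull: "scale (of_nat n) (x - p1) \<in> root_lattice 9" "scale (of_nat n) (x - p1) 1 = 0"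
    "scale (of_nat n) (x - p1) 2 = 0" "scale (of_nat n) (y - p2) \<in> root_lattice 9"
    "scale (of_nat n) (z - p3) = 0"
    unfolding frame_fibre_0_iff by blast+
  have p1: "p1 \<in> rat_space 9" and p2: "p2 \<in> rat_space 9"
    using hull(1,4) n(1) x y by (auto simp: root_lattice_def rat_space_def scale_def A9_coset_def)
  have p3: "p3 = z"
    using hull(5) n(1) by (auto simp: scale_def fun_eq_iff)
  have p12: "p1 1 = x 1" "p1 2 = x 2"
    using hull(2,3) n(1) by (auto simp: scale_def)
  have orth_p: "A_form 9 p1 x' + A_form 9 p2 y' = 0" if "(x', y', 0) \<in> frame_fibre 0" for x' y'
    using p that unfolding orth_in_def p_eq
    by (fastforce simp: root_form_def[of _ _ _ "0 :: qvec"])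
  have "p2 = 0"
  proof (rule A9_orth_imp_0[OF p2])
    fix i :: nat assume "i \<in> {1..9}"
    then have "(0, simple_root i, 0) \<in> frame_fibre 0"
      using simple_root_in_root_lattice[of i 9] by (simp add: frame_fibre_0_iff root_lattice_0)
    from orth_p[OF this] show "p2 i = 0 \<or> A_form 9 p2 (simple_root i) = 0"
      by (simp add: root_form_def[of _ _ _ "0 :: qvec"])
  qed
  moreover have "p1 - ?x = 0"
  proof (rule A9_orth_imp_0)
    show "p1 - ?x \<in> rat_space 9"
      using p1 by (auto simp: rat_space_def scale_def perp_vec_def)
    fix i :: nat assume i: "i \<in> {1..9}"
    show "(p1 - ?x) i = 0 \<or> A_form 9 (p1 - ?x) (simple_root i) = 0"
    proof (cases "i \<in> {1, 2}")
      case True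
      then show ?thesis
        using p12 x12 by (auto simp: scale_def perp_vec_def)
    next
      case False
      with i have s: "(simple_root i, 0, 0) \<in> frame_fibre 0"
        using simple_root_in_root_lattice[of i 9]
        by (simp add: frame_fibre_0_iff root_lattice_0) (simp add: simple_root_def)
      have "A_form 9 (p1 - ?x) (simple_root i) = A_form 9 p1 (simple_root i) - A_form 9 ?x (simple_root i)"
        unfolding A9_form_eq by (simp add: algebra_simps)
      moreover have "A_form 9 p1 (simple_root i) = 0"
        using orth_p[OF s] by (simp add: root_form_def[of _ _ _ "0 :: qvec"])
      moreover have "A_form 9 ?x (simple_root i) = 0"
        using False by (intro orth) (auto simp: simple_root_def)
      ultimately show ?thesis
        by simp
    qed
  qed
  ultimately show "p = (?x, 0, scale (of_int c) delta6')"
    by (simp add: p_eq p3 z)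
qed

lemma height_frame_fibre:
  "height (frame_fibre (m, c)) (frame_fibre (m', c')) = of_int (m * m' + 15 * c * c') / 10"
  unfolding height_def
proof (rule the_equality)
  have h: "of_int (m * m' + 15 * c * c') / 10 =
      - L_form (orth_proj L_form W_root v) (orth_proj L_form W_root w)"
    if "v \<in> frame_fibre (m, c)" "w \<in> frame_fibre (m', c')" for v w
    unfolding orth_proj_frame_fibre[OF that(1)] orth_proj_frame_fibre[OF that(2)] L_form_scale_perp
    by simp
  then show "\<forall>x\<in>frame_fibre (m, c). \<forall>y\<in>frame_fibre (m', c').
      of_int (m * m' + 15 * c * c') / 10 = - L_form (orth_proj L_form W_root x) (orth_proj L_form W_root y)"
    by blast
  fix h
  assume "\<forall>x\<in>frame_fibre (m, c). \<forall>y\<in>frame_fibre (m', c').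
    h = - L_form (orth_proj L_form W_root x) (orth_proj L_form W_root y)"
  \<comment> \<open>The fibres are nonempty, so a pair of representatives exists and determines
    h.\<close>
  then show "h = of_int (m * m' + 15 * c * c') / 10"
    using h frame_fibre_nonempty[of "(m, c)"] frame_fibre_nonempty[of "(m', c')"] by metis
qed

section \<open>The Mordell-Weil group\<close>

lemma add_subgroup_W: "add_subgroup W"
  unfolding add_subgroup_def
proof (intro conjI ballI)
  show "0 \<in> W"
    unfolding W_eq using add_subgroupD(1)[OF add_subgroup_frame_fibre_0] by blast
  show "v + w \<in> W" if "v \<in> W" "w \<in> W" for v w
    using that frame_fibre_add unfolding W_eq by blast
  show "- v \<in> W" if "v \<in> W" for v
    using that frame_fibre_uminus unfolding W_eq by blast
qed

lemma add_subgroup_N: "add_subgroup N"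
  unfolding add_subgroup_def
proof (intro conjI ballI)
  show "0 \<in> N"
    unfolding N_eq using add_subgroupD(1)[OF add_subgroup_frame_fibre_0]
    by (intro UN_I[of 0]) auto
  show "v + w \<in> N" if v: "v \<in> N" and w: "w \<in> N" for v w
  proof -
    obtain p q where "v \<in> frame_fibre p" "w \<in> frame_fibre q"
      and "5 dvd fst p" "2 dvd snd p" "5 dvd fst q" "2 dvd snd q"
      using v w unfolding N_eq by blast
    then show ?thesis
      unfolding N_eq by (intro UN_I[of "p + q"] frame_fibre_add) auto
  qed
  show "- v \<in> N" if v: "v \<in> N" for v
  proof -
    obtain p where "v \<in> frame_fibre p" "5 dvd fst p" "2 dvd snd p"
      using v unfolding N_eq by blast
    then show ?thesis
      unfolding N_eq by (intro UN_I[of "- p"] frame_fibre_uminus) auto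
  qed
qed

lemma N_subset_W: "N \<subseteq> W"
  unfolding N_eq W_eq by blast

lemma frame_fibre_subset_W: "frame_fibre p \<subseteq> W"
  unfolding W_eq by blast

lemma normal_add_grp:
  assumes "add_subgroup S" "add_subgroup T" "T \<subseteq> S"
  shows "T \<lhd> add_grp S"
proof -
  interpret comm_group "add_grp S"
    by (rule comm_group_add_grp) fact
  show ?thesis
    using assms by (intro subgroup_imp_normal subgroup_add_grp)
qed

text \<open>Fibres add, hence they are the translates of the zero fibre. The set \<open>S\<close> is
  arbitrary so that cosets in \<open>W\<close> and in \<open>N\<close> are covered together.\<close>

lemma frame_fibre_0_coset:
  assumes "w \<in> frame_fibre p"
  shows "frame_fibre 0 #>\<^bsub>add_grp S\<^esub> w = frame_fibre p"
proof (intro subset_antisym subsetI)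
  fix v assume "v \<in> frame_fibre 0 #>\<^bsub>add_grp S\<^esub> w"
  then obtain u where "u \<in> frame_fibre 0" "v = u + w"
    by (auto simp: r_coset_def)
  then show "v \<in> frame_fibre p"
    using frame_fibre_add[of u 0 w p] assms by simp
next
  fix v assume "v \<in> frame_fibre p"
  then have "v + - w \<in> frame_fibre (p + - p)"
    using assms by (intro frame_fibre_add frame_fibre_uminus)
  then have "v - w \<in> frame_fibre 0"
    by simp
  then show "v \<in> frame_fibre 0 #>\<^bsub>add_grp S\<^esub> w"
    unfolding r_coset_def by (intro UN_I[of "v - w"]) auto
qed

lemma set_mult_frame_fibre:
  "frame_fibre p <#>\<^bsub>add_grp S\<^esub> frame_fibre q = frame_fibre (p + q)"
proof (intro subset_antisym subsetI)
  fix v assume "v \<in> frame_fibre p <#>\<^bsub>add_grp S\<^esub> frame_fibre q"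
  then show "v \<in> frame_fibre (p + q)"
    by (auto simp: set_mult_def intro: frame_fibre_add)
next
  fix v assume v: "v \<in> frame_fibre (p + q)"
  obtain w where w: "w \<in> frame_fibre q"
    using frame_fibre_nonempty by blast
  have "v + - w \<in> frame_fibre ((p + q) + - q)"
    using v w by (intro frame_fibre_add frame_fibre_uminus)
  then have "v - w \<in> frame_fibre p"
    by simp
  then show "v \<in> frame_fibre p <#>\<^bsub>add_grp S\<^esub> frame_fibre q"
    using w unfolding set_mult_def by (intro UN_I[of "v - w"] UN_I[of w]) auto
qed

lemma rcosets_frame_fibre_0:
  assumes "S = (\<Union>p\<in>P. frame_fibre p)"
  shows "rcosets\<^bsub>add_grp S\<^esub> frame_fibre 0 = frame_fibre ` P"
proof (intro subset_antisym subsetI)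
  fix C assume "C \<in> rcosets\<^bsub>add_grp S\<^esub> frame_fibre 0"
  then obtain w where w: "w \<in> S" "C = frame_fibre 0 #>\<^bsub>add_grp S\<^esub> w"
    by (auto simp: RCOSETS_def)
  then obtain p where "p \<in> P" "w \<in> frame_fibre p"
    unfolding assms by blast
  then show "C \<in> frame_fibre ` P"
    using frame_fibre_0_coset w(2) by blast
next
  fix C assume "C \<in> frame_fibre ` P"
  then obtain p where p: "p \<in> P" "C = frame_fibre p"
    by blast
  obtain w where w: "w \<in> frame_fibre p"
    using frame_fibre_nonempty by blast
  then have "w \<in> S"
    using p unfolding assms by blast
  moreover have "C = frame_fibre 0 #>\<^bsub>add_grp S\<^esub> w"
    using frame_fibre_0_coset[OF w] p by blast
  ultimately show "C \<in> rcosets\<^bsub>add_grp S\<^esub> frame_fibre 0"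
    unfolding RCOSETS_def by auto
qed

lemma MW_simps:
  "carrier MW = range frame_fibre"
  "X \<otimes>\<^bsub>MW\<^esub> Y = X <#>\<^bsub>add_grp W\<^esub> Y"
  "\<one>\<^bsub>MW\<^esub> = frame_fibre 0"
  unfolding MW_def W_root_eq FactGroup_def using rcosets_frame_fibre_0[of W UNIV] W_eq by simp_all

lemma group_MW: "group MW"
  unfolding MW_def W_root_eq
  by (intro normal.factorgroup_is_group normal_add_grp add_subgroup_W add_subgroup_frame_fibre_0
      frame_fibre_subset_W)

text \<open>This is the inverse of the coordinate isomorphism from the Mordell-Weil group to Z^2; it
  moves questions of generation to Z^2.\<close>

lemma group_hom_frame_fibre: "group_hom (add_grp UNIV) MW frame_fibre"
proof -
  have "group (add_grp UNIV :: (int \<times> int) monoid)"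
    by (rule comm_group.axioms(2)[OF comm_group_add_grp[OF add_subgroup_UNIV]])
  then show ?thesis
    using group_MW
    by (simp add: group_hom_def group_hom_axioms_def hom_def MW_simps set_mult_frame_fibre)
qed

lemma generate_MW: "generate MW (frame_fibre ` K) = frame_fibre ` int_span K"
proof -
  interpret group_hom "add_grp UNIV" MW frame_fibre
    by (rule group_hom_frame_fibre)
  show ?thesis
    unfolding int_span_def by (rule generate_img) simp
qed

section \<open>Pairs of generators and equivalence of binary forms\<close>

lemma int_span_pair_mem:
  fixes m c m' c' k l :: int
  shows "(k * m + l * m', k * c + l * c') \<in> int_span {(m, c), (m', c')}"
proof -
  note S = add_subgroup_int_span[of "{(m, c), (m', c')}"]
  have "(k * m, k * c) \<in> int_span {(m, c), (m', c')}"
    by (rule add_subgroup_zmult_mem[OF S, of "\<lambda>k. (k * m, k * c)"])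
      (auto simp: algebra_simps intro: int_span_incl)
  moreover have "(l * m', l * c') \<in> int_span {(m, c), (m', c')}"
    by (rule add_subgroup_zmult_mem[OF S, of "\<lambda>l. (l * m', l * c')"])
      (auto simp: algebra_simps intro: int_span_incl)
  ultimately show ?thesis
    using add_subgroupD(2)[OF S] by fastforce
qed

text \<open>Cramer's rule. Determinant 1 or -1 is expressed by its square being 1, so that the
  determinant \<open>d\<close> is its own inverse and no division occurs.\<close>

lemma int_span_pair_unimodular:
  fixes m c m' c' :: int
  assumes "(m * c' - m' * c) * (m * c' - m' * c) = 1"
  shows "int_span {(m, c), (m', c')} = UNIV"
proof (intro equalityI subset_UNIV subsetI)
  fix r :: "int \<times> int"
  obtain a b where r: "r = (a, b)"
    by (metis prod.exhaust)
  define d where "d = m * c' - m' * c"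
  have "(d * (a * c' - b * m')) * m + (d * (m * b - c * a)) * m' = d * d * a"
    "(d * (a * c' - b * m')) * c + (d * (m * b - c * a)) * c' = d * d * b"
    by (simp_all add: d_def algebra_simps)
  then show "r \<in> int_span {(m, c), (m', c')}"
    using int_span_pair_mem[of "d * (a * c' - b * m')" m "d * (m * b - c * a)" m' c c'] assms
    by (simp add: r d_def)
qed

lemma int_span_N: "int_span {(5, 0), (0, 2)} = {p :: int \<times> int. 5 dvd fst p \<and> 2 dvd snd p}"
  (is "?L = ?R")
proof (intro subset_antisym)
  show "?L \<subseteq> ?R"
    by (rule int_span_subset) (auto simp: add_subgroup_def)
  show "?R \<subseteq> ?L"
  proof
    fix p assume "p \<in> ?R"
    then obtain k l where "p = (k * 5 + l * 0, k * 0 + l * 2)"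
      by (auto elim!: dvdE simp: prod_eq_iff)
    then show "p \<in> ?L"
      by (simp only: int_span_pair_mem)
  qed
qed

lemma generate_MW_unimodular:
  assumes "(m * c' - m' * c) * (m * c' - m' * c) = 1"
  shows "generate MW {frame_fibre (m, c), frame_fibre (m', c')} = carrier MW"
  using generate_MW[of "{(m, c), (m', c')}"] int_span_pair_unimodular[OF assms]
  by (simp add: MW_simps)

lemma quad_form_height:
  "quad_form (height_matrix (frame_fibre (m, c)) (frame_fibre (m', c'))) v =
     ((of_int m * v $ 1 + of_int m' * v $ 2)\<^sup>2 + 15 * (of_int c * v $ 1 + of_int c' * v $ 2)\<^sup>2) / 10"
  by (simp add: quad_form_def height_matrix_def height_frame_fibre sum_2 power2_eq_square field_simps)

lemma GL2Z_equivalent_height: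
  assumes "(m * c' - m' * c) * (m * c' - m' * c) = 1"
  shows "GL2Z_equivalent (quad_form (height_matrix (frame_fibre (m, c)) (frame_fibre (m', c'))))
    (\<lambda>v. ((v $ 1)\<^sup>2 + 15 * (v $ 2)\<^sup>2) / 10)"
proof -
  define d where "d = m * c' - m' * c"
  have dd: "d * (m * c') = 1 + d * (m' * c)"
    using assms by (simp add: d_def algebra_simps)
  \<comment> \<open>This is \<open>d\<close> times the adjugate of \<open>Q\<close>, hence the
    inverse of \<open>Q\<close> because d^2 = 1. By \<open>quad_form_height\<close> the height form
    is the diagonal form composed with \<open>Q\<close>, so composing with \<open>P\<close> undoes
    it.\<close>
  define P :: "int^2^2" where "P = vector [vector [d * c', - d * m'], vector [- d * c, d * m]]"
  define Q :: "int^2^2" where "Q = vector [vector [m, m'], vector [c, c']]"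
  have "P ** Q = mat 1" "Q ** P = mat 1"
    using dd by (simp_all add: P_def Q_def matrix_matrix_mult_def mat_def vec_eq_iff forall_2 sum_2 algebra_simps)
  then have "invertible P"
    unfolding invertible_def by blast
  moreover have "quad_form (height_matrix (frame_fibre (m, c)) (frame_fibre (m', c')))
      ((\<chi> i j. of_int (P $ i $ j)) *v v) = ((v $ 1)\<^sup>2 + 15 * (v $ 2)\<^sup>2) / 10" for v :: "rat^2"
  proof -
    have Pv: "((\<chi> i j. of_int (P $ i $ j)) *v v) $ 1 = of_int (d * c') * v $ 1 - of_int (d * m') * v $ 2"
      "((\<chi> i j. of_int (P $ i $ j)) *v v) $ 2 = - of_int (d * c) * v $ 1 + of_int (d * m) * v $ 2"
      by (simp_all add: P_def matrix_vector_mult_def sum_2)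
    have dd': "of_int d * (of_int m * of_int c') = (1 + of_int d * (of_int m' * of_int c) :: rat)"
      using arg_cong[OF dd, of "of_int :: int \<Rightarrow> rat"] by simp
    have "of_int m * (of_int (d * c') * v $ 1 - of_int (d * m') * v $ 2)
        + of_int m' * (- of_int (d * c) * v $ 1 + of_int (d * m) * v $ 2)
        = (of_int d * (of_int m * of_int c') - of_int d * (of_int m' * of_int c)) * v $ 1"
      "of_int c * (of_int (d * c') * v $ 1 - of_int (d * m') * v $ 2)
        + of_int c' * (- of_int (d * c) * v $ 1 + of_int (d * m) * v $ 2)
        = (of_int d * (of_int m * of_int c') - of_int d * (of_int m' * of_int c)) * v $ 2"
      by (simp_all add: algebra_simps)
    then show ?thesis
      unfolding quad_form_height Pv dd' by simp
  qed
  ultimately show ?thesis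
    unfolding GL2Z_equivalent_def by (intro exI[of _ P]) simp
qed

section \<open>Orders modulo \<open>N\<close> and the index of \<open>N\<close>\<close>

lemma nat_pow_frame_fibre:
  assumes "w \<in> frame_fibre (m, c)"
  shows "w [^]\<^bsub>add_grp W\<^esub> (n :: nat) \<in> frame_fibre (int n * m, int n * c)"
proof (induction n)
  case 0
  show ?case
    using add_subgroupD(1)[OF add_subgroup_frame_fibre_0] by (simp add: nat_pow_def zero_prod_def)
next
  case (Suc n)
  have "w [^]\<^bsub>add_grp W\<^esub> Suc n = w [^]\<^bsub>add_grp W\<^esub> n + w"
    by (simp add: nat_pow_def)
  then show ?case
    using frame_fibre_add[OF Suc assms] by (simp add: algebra_simps)
qed

text \<open>The n-fold of w lies over (n m, n c), so it is in \<open>N\<close> exactly under the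
  divisibilities of \<open>N_eq\<close>. The order and \<open>k\<close> thus divide the same natural
  numbers.\<close>

lemma ord_mod_N:
  assumes w: "w \<in> frame_fibre (m, c)"
    and k: "\<And>n :: nat. 5 dvd int n * m \<and> 2 dvd int n * c \<longleftrightarrow> k dvd n"
  shows "group.ord (add_grp W Mod N) (N #>\<^bsub>add_grp W\<^esub> w) = k"
proof -
  interpret W: comm_group "add_grp W"
    by (rule comm_group_add_grp[OF add_subgroup_W])
  interpret N: normal N "add_grp W"
    by (rule normal_add_grp[OF add_subgroup_W add_subgroup_N N_subset_W])
  interpret Q: group "add_grp W Mod N"
    by (rule N.factorgroup_is_group)
  interpret h: group_hom "add_grp W" "add_grp W Mod N" "(#>\<^bsub>add_grp W\<^esub>) N"
    by unfold_locales (rule N.r_coset_hom_Mod)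
  have wW: "w \<in> carrier (add_grp W)"
    using w frame_fibre_subset_W by auto
  let ?x = "N #>\<^bsub>add_grp W\<^esub> w"
  have "Q.ord ?x dvd n \<longleftrightarrow> k dvd n" for n
  proof -
    have "Q.ord ?x dvd n \<longleftrightarrow> ?x [^]\<^bsub>add_grp W Mod N\<^esub> n = \<one>\<^bsub>add_grp W Mod N\<^esub>"
      using Q.pow_eq_id[of ?x n] h.hom_closed[OF wW] by simp
    also have "\<dots> \<longleftrightarrow> N #>\<^bsub>add_grp W\<^esub> (w [^]\<^bsub>add_grp W\<^esub> n) = N"
      using h.hom_nat_pow[OF wW, of n] by simp
    also have "\<dots> \<longleftrightarrow> w [^]\<^bsub>add_grp W\<^esub> n \<in> N"
      using W.coset_join1[OF _ W.nat_pow_closed[OF wW] N.subgroup_axioms]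
        W.coset_join2[OF W.nat_pow_closed[OF wW] N.subgroup_axioms] N.subset by blast
    also have "\<dots> \<longleftrightarrow> 5 dvd int n * m \<and> 2 dvd int n * c"
    proof
      assume "w [^]\<^bsub>add_grp W\<^esub> n \<in> N"
      then obtain p where p: "5 dvd fst p" "2 dvd snd p" "w [^]\<^bsub>add_grp W\<^esub> n \<in> frame_fibre p"
        unfolding N_eq by blast
      have "p = (int n * m, int n * c)"
        by (rule frame_fibre_unique[OF p(3) nat_pow_frame_fibre[OF w]])
      then show "5 dvd int n * m \<and> 2 dvd int n * c"
        using p(1,2) by simp
    next
      assume "5 dvd int n * m \<and> 2 dvd int n * c"
      then show "w [^]\<^bsub>add_grp W\<^esub> n \<in> N"
        unfolding N_eq using nat_pow_frame_fibre[OF w, of n]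
        by (intro UN_I[of "(int n * m, int n * c)"]) auto
    qed
    finally show ?thesis
      using k by simp
  qed
  from this[of k] this[of "Q.ord ?x"] show ?thesis
    by (simp add: dvd_antisym)
qed

text \<open>A coset is determined by the residues of m modulo 5 and of c modulo 2, and all ten pairs
  of residues occur.\<close>

lemma card_rcosets_N:
  "card (rcosets\<^bsub>MW\<^esub> (frame_fibre ` {p. 5 dvd fst p \<and> 2 dvd snd p})) = 10"
proof -
  let ?M = "{p :: int \<times> int. 5 dvd fst p \<and> 2 dvd snd p}"
  let ?C = "\<lambda>(i, j). frame_fibre ` {p. fst p mod 5 = i \<and> snd p mod 2 = j}"
  have coset: "frame_fibre ` ?M #>\<^bsub>MW\<^esub> frame_fibre q = ?C (fst q mod 5, snd q mod 2)" for q
  proof -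
    have "frame_fibre ` ?M #>\<^bsub>MW\<^esub> frame_fibre q = frame_fibre ` ((\<lambda>p. p + q) ` ?M)"
      by (simp add: r_coset_def MW_simps set_mult_frame_fibre image_image) blast
    also have "(\<lambda>p. p + q) ` ?M = {p. fst p mod 5 = fst q mod 5 \<and> snd p mod 2 = snd q mod 2}"
    proof (intro subset_antisym subsetI)
      fix p assume "p \<in> {p. fst p mod 5 = fst q mod 5 \<and> snd p mod 2 = snd q mod 2}"
      then have "p - q \<in> ?M"
        by (simp add: mod_eq_dvd_iff)
      then show "p \<in> (\<lambda>p. p + q) ` ?M"
        by (intro image_eqI[of _ _ "p - q"]) simp_all
    qed (auto simp: mod_eq_dvd_iff)
    finally show ?thesis
      by simp
  qed
  have "rcosets\<^bsub>MW\<^esub> (frame_fibre ` ?M) = range (\<lambda>q. ?C (fst q mod 5, snd q mod 2))"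
    unfolding RCOSETS_def MW_simps using coset by auto
  also have "\<dots> = ?C ` range (\<lambda>q :: int \<times> int. (fst q mod 5, snd q mod 2))"
    by (simp only: image_image)
  also have "range (\<lambda>q :: int \<times> int. (fst q mod 5, snd q mod 2)) = {0..<5} \<times> {0..<2}"
  proof (intro subset_antisym subsetI)
    fix q :: "int \<times> int" assume "q \<in> {0..<5} \<times> {0..<2}"
    then show "q \<in> range (\<lambda>q. (fst q mod 5, snd q mod 2))"
      by (intro image_eqI[of _ _ q]) auto
  qed auto
  also have "card (?C ` ({0..<5} \<times> {0..<2})) = card ({0..<5 :: int} \<times> {0..<2 :: int})"
  proof (rule card_image, rule inj_onI)
    fix r s assume rs: "r \<in> {0..<5 :: int} \<times> {0..<2 :: int}" "s \<in> {0..<5 :: int} \<times> {0..<2 :: int}"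
      and "?C r = ?C s"
    \<comment> \<open>A reduced pair is its own residue, so this element distinguishes the
      cosets.\<close>
    have "frame_fibre r \<in> ?C r"
      using rs by (auto simp: case_prod_beta intro!: imageI)
    then have "frame_fibre r \<in> ?C s"
      using \<open>?C r = ?C s\<close> by simp
    then obtain p where "frame_fibre r = frame_fibre p" "fst p mod 5 = fst s" "snd p mod 2 = snd s"
      by (auto simp: case_prod_beta)
    moreover from this have "r = p"
      using frame_fibre_nonempty frame_fibre_unique by metis
    ultimately show "r = s"
      using rs by (auto simp: prod_eq_iff)
  qed
  finally show ?thesis
    by simp
qed

section \<open>Coordinates of the sections\<close>

text \<open>The first coordinate of alpha_j is -(10 - j)/10 = m/5, which gives m. An even j is at
  least 2, so the second coordinate is twice the first.\<close>

lemma frame_fibreI: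
  assumes "j \<in> {1..9}" "m = (int j - 10) div 2" "even j" "y \<in> A9_coset k" "k mod 10 = (5 * c - 4 * m) mod 10"
    "z = scale (of_int c) delta6'"
  shows "(\<alpha>\<^sub>9 j, y, z) \<in> frame_fibre (m, c)"
proof -
  obtain i where j: "j = 2 * i"
    using assms(3) by (auto elim: evenE)
  have m: "m = int i - 5"
    using assms(2) j by simp
  have "- 2 * m = - int j + 10"
    by (simp add: m j)
  then have "\<alpha>\<^sub>9 j \<in> A9_coset (- 2 * m)"
    by (intro A9_coset_mod[OF A9_dual_basis_coset[OF assms(1)]]) (metis mod_add_self2)
  moreover have "\<alpha>\<^sub>9 j 1 = of_int m / 5" "\<alpha>\<^sub>9 j 2 = 2 * of_int m / 5"
    using assms(1) unfolding A9_dual_basis[OF assms(1)] by (auto simp: m j field_simps)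
  moreover have "y \<in> A9_coset (5 * c - 4 * m)"
    by (rule A9_coset_mod) fact+
  ultimately show ?thesis
    using assms(6) by (simp add: frame_fibre_iff)
qed

lemma class_mod_sect:
  assumes "fibration_with_frame_W H NS \<phi>" "\<omega> \<in> W"
  shows "class_mod \<phi> R (sect \<phi> k \<omega>) = R #>\<^bsub>add_grp W\<^esub> \<omega>"
proof -
  have "inj_on \<phi> (UNIV \<times> W)"
    using assms(1) by (simp add: fibration_with_frame_W_def lattice_isometry_def bij_betw_def)
  then show ?thesis
    using assms(2) by (simp add: class_mod_def frame_part_def sect_def inv_into_f_f)
qed

text \<open>In order, the coordinates (m, c) of Z1, Z2, Z3, Z5, Z7, Z9, Z11, Z12. A section with c =
  1 has determinant -1 with Z2, and the pairs Z1, Z3 and Z1, Z9 have determinants 1 and -1.\<close>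

lemma section_frame_parts:
  "(\<alpha>\<^sub>9 4, \<alpha>\<^sub>9 3, delta6') \<in> frame_fibre (-3, 1)"
  "(\<alpha>\<^sub>9 8, \<alpha>\<^sub>9 6, 0) \<in> frame_fibre (-1, 0)"
  "(\<alpha>\<^sub>9 2, \<alpha>\<^sub>9 9, delta6') \<in> frame_fibre (-4, 1)"
  "(0, \<alpha>\<^sub>9 5, delta6') \<in> frame_fibre (0, 1)"
  "(\<alpha>\<^sub>9 8, \<alpha>\<^sub>9 1, delta6') \<in> frame_fibre (-1, 1)"
  "(\<alpha>\<^sub>9 6, \<alpha>\<^sub>9 7, delta6') \<in> frame_fibre (-2, 1)"
  "(vec_of [1, 2, 1], 0, 0) \<in> frame_fibre (5, 0)"
  "(0, 0, scale 2 delta6') \<in> frame_fibre (0, 2)"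
proof -
  have s: "0 = scale (of_int 0) delta6'" "delta6' = scale (of_int 1) delta6'"
    by (simp_all add: scale_def fun_eq_iff)
  note * = frame_fibreI[OF _ _ _ A9_dual_basis_coset]
  show "(\<alpha>\<^sub>9 4, \<alpha>\<^sub>9 3, delta6') \<in> frame_fibre (-3, 1)" "(\<alpha>\<^sub>9 8, \<alpha>\<^sub>9 6, 0) \<in> frame_fibre (-1, 0)"
    "(\<alpha>\<^sub>9 2, \<alpha>\<^sub>9 9, delta6') \<in> frame_fibre (-4, 1)" "(\<alpha>\<^sub>9 8, \<alpha>\<^sub>9 1, delta6') \<in> frame_fibre (-1, 1)"
    "(\<alpha>\<^sub>9 6, \<alpha>\<^sub>9 7, delta6') \<in> frame_fibre (-2, 1)"
    by (rule *; (rule s(1) | rule s(2) | simp))+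
  \<comment> \<open>For Z5 the first component is 0 instead of a dual basis vector, so
    \<open>frame_fibreI\<close> does not apply; the classes -5 and 5 coincide.\<close>
  have "\<alpha>\<^sub>9 5 \<in> A9_coset (5 * 1 - 4 * 0)"
    by (rule A9_coset_mod[OF A9_dual_basis_coset]) simp_all
  then show "(0, \<alpha>\<^sub>9 5, delta6') \<in> frame_fibre (0, 1)"
    unfolding frame_fibre_iff using s(2) by (simp add: A9_coset_0 root_lattice_0)
  have "vec_of [1, 2, 1] \<in> root_lattice 9"
  proof (rule root_lattice_9I)
    show "vec_of [1, 2, 1] i \<in> \<int>" for i
      by (cases "i \<in> {1, 2, 3}") (auto simp: vec_of_def)
  qed (auto simp: vec_of_def rat_space_def)
  then have "vec_of [1, 2, 1] \<in> A9_coset (- 2 * 5)"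
    using A9_coset_mod[of "vec_of [1, 2, 1]" 0 "- 2 * 5"] by (simp add: A9_coset_0)
  moreover have "0 \<in> A9_coset (5 * 0 - 4 * 5)" "0 \<in> A9_coset (5 * 2 - 4 * 0)"
    by (rule A9_coset_mod[of _ 0]; simp add: A9_coset_0 root_lattice_0)+
  ultimately show "(vec_of [1, 2, 1], 0, 0) \<in> frame_fibre (5, 0)"
    "(0, 0, scale 2 delta6') \<in> frame_fibre (0, 2)"
    using s(1)[symmetric] by (simp_all add: frame_fibre_iff vec_of_def A9_coset_0 root_lattice_0)
qed

lemmas section_defs = Z1_def Z2_def Z3_def Z5_def Z7_def Z9_def Z11_def Z12_def

lemma class_mod_section:
  assumes "fibration_with_frame_W H NS \<phi>" "\<omega> \<in> frame_fibre p"
  shows "class_mod \<phi> (frame_fibre 0) (sect \<phi> k \<omega>) = frame_fibre p"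
    "class_mod \<phi> N (sect \<phi> k \<omega>) = N #>\<^bsub>add_grp W\<^esub> \<omega>"
  using class_mod_sect[OF assms(1)] assms(2) frame_fibre_subset_W frame_fibre_0_coset[OF assms(2)]
  by blast+

theorem theorem3:
  fixes H :: "'h::ab_group_add \<Rightarrow> 'h \<Rightarrow> rat"
    and NS :: "'h set"
    and \<phi> :: "(int \<times> int) \<times> ambient \<Rightarrow> 'h"
  assumes "K3_lattice_form H"
    and "NS_with_transcendental_6_2 H NS"
    and "fibration_with_frame_W H NS \<phi>"
  shows
    "(\<forall>Z \<in> {Z1 \<phi>, Z3 \<phi>, Z7 \<phi>, Z9 \<phi>, Z5 \<phi>}. generate MW {mw \<phi> (Z2 \<phi>), mw \<phi> Z} = carrier MW) \<and>
     (\<forall>Z \<in> {Z1 \<phi>, Z3 \<phi>, Z7 \<phi>, Z9 \<phi>}. group.ord (add_grp W Mod N) (class_mod \<phi> N Z) = 10) \<and>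
     group.ord (add_grp W Mod N) (class_mod \<phi> N (Z5 \<phi>)) = 2 \<and>
     generate MW {mw \<phi> (Z1 \<phi>), mw \<phi> (Z3 \<phi>)} = carrier MW \<and>
     generate MW {mw \<phi> (Z1 \<phi>), mw \<phi> (Z9 \<phi>)} = carrier MW \<and>
     (\<forall>(Z, Z') \<in> {(Z2 \<phi>, Z1 \<phi>), (Z2 \<phi>, Z3 \<phi>), (Z2 \<phi>, Z7 \<phi>), (Z2 \<phi>, Z9 \<phi>), (Z2 \<phi>, Z5 \<phi>),
                    (Z1 \<phi>, Z3 \<phi>), (Z1 \<phi>, Z9 \<phi>)}.
        GL2Z_equivalent (quad_form (height_matrix (mw \<phi> Z) (mw \<phi> Z')))
          (\<lambda>v. 1/10 * ((v $ 1)\<^sup>2 + 15 * (v $ 2)\<^sup>2))) \<and>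
     card (rcosets\<^bsub>add_grp W Mod N_root\<^esub> (carrier (add_grp N Mod N_root))) = 10 \<and>
     mw \<phi> (Z11 \<phi>) = mw \<phi> (Z2 \<phi>) [^]\<^bsub>MW\<^esub> (-5::int) \<and>
     generate (add_grp W Mod N_root) {class_mod \<phi> N_root (Z11 \<phi>), class_mod \<phi> N_root (Z12 \<phi>)}
       = carrier (add_grp N Mod N_root)"
proof -
  note fib = assms(3)
  have classes: "class_mod \<phi> (frame_fibre 0) (Z1 \<phi>) = frame_fibre (-3, 1)"
    "class_mod \<phi> (frame_fibre 0) (Z2 \<phi>) = frame_fibre (-1, 0)"
    "class_mod \<phi> (frame_fibre 0) (Z3 \<phi>) = frame_fibre (-4, 1)"
    "class_mod \<phi> (frame_fibre 0) (Z5 \<phi>) = frame_fibre (0, 1)"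
    "class_mod \<phi> (frame_fibre 0) (Z7 \<phi>) = frame_fibre (-1, 1)"
    "class_mod \<phi> (frame_fibre 0) (Z9 \<phi>) = frame_fibre (-2, 1)"
    "class_mod \<phi> (frame_fibre 0) (Z11 \<phi>) = frame_fibre (5, 0)"
    "class_mod \<phi> (frame_fibre 0) (Z12 \<phi>) = frame_fibre (0, 2)"
    unfolding section_defs by (rule class_mod_section(1)[OF fib] section_frame_parts)+
  note classes_N = section_frame_parts[THEN class_mod_section(2)[OF fib]]
  \<comment> \<open>\<open>W_root\<close> and \<open>N_root\<close> are both the zero fibre, so the
    quotient of \<open>W\<close> by \<open>N_root\<close> is the Mordell-Weil group itself.\<close>
  have mod_N_root: "add_grp W Mod frame_fibre 0 = MW"
    by (simp add: MW_def W_root_eq)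
  have carrier_N: "carrier (add_grp N Mod frame_fibre 0) = frame_fibre ` {p. 5 dvd fst p \<and> 2 dvd snd p}"
    using rcosets_frame_fibre_0[OF N_eq] by (simp add: FactGroup_def)
  have gen: "generate MW {frame_fibre (5, 0), frame_fibre (0, 2)} = frame_fibre ` {p. 5 dvd fst p \<and> 2 dvd snd p}"
    using generate_MW[of "{(5, 0), (0, 2)}"] by (simp add: int_span_N)
  \<comment> \<open>Here m is prime to 5 and c = 1, so n must be divisible by both 5 and 2.\<close>
  have ten: "group.ord (add_grp W Mod N) (N #>\<^bsub>add_grp W\<^esub> w) = 10"
    if "w \<in> frame_fibre (m, 1)" "m \<in> {-1, -2, -3, -4}" for w m
  proof (rule ord_mod_N[OF that(1)])
    fix n :: nat
    show "5 dvd int n * m \<and> 2 dvd int n * 1 \<longleftrightarrow> 10 dvd n"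
      using that(2) by (elim insertE emptyE; simp; presburger)
  qed
  have two: "group.ord (add_grp W Mod N) (N #>\<^bsub>add_grp W\<^esub> w) = 2"
    if "w \<in> frame_fibre (0, 1)" for w
    by (rule ord_mod_N[OF that]) simp
  have ords: "group.ord (add_grp W Mod N) (class_mod \<phi> N (Z1 \<phi>)) = 10"
    "group.ord (add_grp W Mod N) (class_mod \<phi> N (Z3 \<phi>)) = 10"
    "group.ord (add_grp W Mod N) (class_mod \<phi> N (Z7 \<phi>)) = 10"
    "group.ord (add_grp W Mod N) (class_mod \<phi> N (Z9 \<phi>)) = 10"
    "group.ord (add_grp W Mod N) (class_mod \<phi> N (Z5 \<phi>)) = 2"
    unfolding section_defs classes_N
    by ((rule ten, rule section_frame_parts, simp) | (rule two, rule section_frame_parts))+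
  interpret group_hom "add_grp UNIV" MW frame_fibre
    by (rule group_hom_frame_fibre)
  \<comment> \<open>The relation Z11 = -5 Z2 is computed in Z^2 and carried over by the
    homomorphism.\<close>
  have "frame_fibre (-1, 0) [^]\<^bsub>MW\<^esub> (-5 :: int) = frame_fibre (5, 0)"
  proof -
    have "frame_fibre (-1, 0) [^]\<^bsub>MW\<^esub> (-5 :: int) = frame_fibre ((-1, 0) [^]\<^bsub>add_grp UNIV\<^esub> (-5 :: int))"
      by (rule hom_int_pow[symmetric]) simp
    also have "(-1, 0) [^]\<^bsub>add_grp UNIV\<^esub> (-5 :: int) = (5 :: int, 0 :: int)"
      by (simp add: int_pow_def nat_pow_def inv_add_grp add_subgroup_UNIV numeral_eq_Suc zero_prod_def)
    finally show ?thesis .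
  qed
  then show ?thesis
    unfolding W_root_eq N_root_eq mod_N_root carrier_N
    by (simp add: classes ords gen card_rcosets_N generate_MW_unimodular GL2Z_equivalent_height)
qed

end
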